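(* Let $\sigma^\infty(C)$ be the 2-dimensional CW-complex obtained by inflation from the Tribonacci topological substitution $\sigma$. Then $\sigma^\infty(C)$ can be realized as a tiling of $\mathbb R^2$ (that is, it has a geometric realization by a polygonal tiling of $\mathbb R^2$, in the sense defined in the context). This tiling is denoted by $\mathcal T_{\mathsf{top}}$.
   Context: **Tilings and geometric realization.** A tile is a compact subset of $\mathbb R^2$ equal to the closure of its interior; tiles may carry labels from a finite set, and a prototile is an equivalence class of (labelled) tiles up to translation. A tiling of $\mathbb R^2$ modeled on a set of prototiles is a set of tiles, each belonging to one of these prototiles, that cover $\mathbb R^2$ and have pairwise disjoint interiors; it is polygonal if all tiles are Euclidean polygons. A tiling whose tiles are homeomorphic to a closed disc defines a 2-dimensional CW-complex $X$ as follows: the vertices of $X$ are the points of $\mathbb R^2$ which belong to at least three tiles; the closed edges of $X$ are the closures of the connected components (open arcs) of the union of the boundaries of the tiles minus the set of vertices, each edge being glued to the endpoints of the arc; the faces of $X$ are the tiles, glued along their boundaries. If $Y$ is a 2-dimensional CW-complex homeomorphic to $\mathbb R^2$, a polygonal tiling is a geometric realization of $Y$ if the complex $X$ it defines is isomorphic, as a CW-complex, to $Y$. **The substitution $\sigma$.** The prototiles are three topological polygons (one-face CW-discs): hexagons $A$, $B$ with cyclically numbered vertices $A_0,\dots,A_5$ and $B_0,\dots,B_5$, and a decagon $C$ with cyclically numbered vertices $C_0,\dots,C_9$. For cyclically consecutive $i,j$, $X_{ij}$ is the edge of $X$ oriented from $X_i$ to $X_j$. $\sigma$ maps each prototile homeomorphically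 onto a patch (a CW-complex homeomorphic to a closed disc, each of whose faces has a type in $\{A,B,C\}$, i.e. is identified with that prototile): - $\sigma(A)$ is one face of type $B$, with $\sigma(A_i)=B_{i+2 \bmod 6}$. - $\sigma(B)$ is one face of type $C$, with $B_0,\dots,B_5\mapsto C_7,C_8,C_1,C_2,C_3,C_6$. - $\sigma(C)$ consists of one face of each type $A,B,C$, glued along $A_{45}=C_{54}$, $A_{43}=C_{56}$, $A_{23}=B_{05}$, $B_{45}=C_{76}$, with $C_0,\dots,C_9\mapsto A_5(=C_4),A_0,B_1,B_2,B_3,B_4(=C_7),C_8,C_1,C_2,C_3$. The image of an edge is the boundary arc between the images of its endpoints containing no other image of a vertex: $\sigma(B_{12})=C_{89}C_{90}C_{01}$, $\sigma(B_{45})=C_{34}C_{45}C_{56}$, $\sigma(C_{12})=A_{01}A_{12}B_{01}$, $\sigma(C_{67})=C_{89}C_{90}C_{01}$, and all other edges are mapped to a single edge. **Iteration and $\sigma^\infty(C)$.** $\sigma^{p+1}(X)$ is obtained by taking a copy of $\sigma(\mathrm{type}(f))$ for each face $f$ of $\sigma^p(X)$ and, for each edge $e$ shared by two faces $f,f'$, gluing edge to edge the two copies along the images under $\sigma$ of the edges of $\mathrm{type}(f)$, $\mathrm{type}(f')$ corresponding to $e$ (these images always have the same number of edges). Identify $C$ with the unique face of type $C$ in $\sigma(C)$; inductively $\sigma^k(C)$ is a subcomplex of $\sigma^{k+1}(C)$. Then $\sigma^\infty(C)=\bigcup_{k\ge0}\sigma^k(C)$, a CW-complex homeomorphic to $\mathbb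 R^2$.
   Formalization: The vertices of X may include, besides the points in at least three tiles, further boundary points subdividing edges; with only the former no tiling realizes σ^∞(C), since its vertex A_4=C_5 lies on exactly two faces. *)

theory Defs
  imports "HOL-Analysis.Analysis"
begin

section \<open>CW structures and their isomorphisms\<close>

text \<open>The data of a CW-complex: its space and, for each \<open>n\<close>, the set of its open \<open>n\<close>-cells,
  each cell being a set of points of the space.\<close>

record 'a cw_structure =
  cw_space :: "'a topology"
  cells :: "nat \<Rightarrow> 'a set set"

definition cw_isomorphic :: "'a cw_structure \<Rightarrow> 'b cw_structure \<Rightarrow> bool" where
  "cw_isomorphic X Y \<longleftrightarrow>
     (\<exists>h. homeomorphic_map (cw_space X) (cw_space Y) h \<and> (\<forall>n. (`) h ` cells X n = cells Y n))"

definition quotient_topology :: "'a topology \<Rightarrow> ('a \<Rightarrow> 'b) \<Rightarrow> 'b topology" where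
  "quotient_topology X q =
     topology (\<lambda>U. U \<subseteq> q ` topspace X \<and> openin X {x \<in> topspace X. q x \<in> U})"

lemma openin_quotient_topology:
  "openin (quotient_topology X q) U \<longleftrightarrow>
     U \<subseteq> q ` topspace X \<and> openin X {x \<in> topspace X. q x \<in> U}"
proof -
  have "istopology (\<lambda>U. U \<subseteq> q ` topspace X \<and> openin X {x \<in> topspace X. q x \<in> U})"
    unfolding istopology_def
  proof (intro conjI allI impI)
    fix S T
    assume "S \<subseteq> q ` topspace X \<and> openin X {x \<in> topspace X. q x \<in> S}"
      and "T \<subseteq> q ` topspace X \<and> openin X {x \<in> topspace X. q x \<in> T}"
    moreover have "{x \<in> topspace X. q x \<in> S \<inter> T} =
        {x \<in> topspace X. q x \<in> S} \<inter> {x \<in> topspace X. q x \<in> T}" by auto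
    ultimately show "openin X {x \<in> topspace X. q x \<in> S \<inter> T}" by auto
    show "S \<inter> T \<subseteq> q ` topspace X"
      using \<open>S \<subseteq> q ` topspace X \<and> _\<close> by auto
  next
    fix K
    assume K: "\<forall>S\<in>K. S \<subseteq> q ` topspace X \<and> openin X {x \<in> topspace X. q x \<in> S}"
    have "{x \<in> topspace X. q x \<in> \<Union>K} = \<Union>((\<lambda>S. {x \<in> topspace X. q x \<in> S}) ` K)" by auto
    then show "openin X {x \<in> topspace X. q x \<in> \<Union>K}" using K by auto
    show "\<Union>K \<subseteq> q ` topspace X" using K by auto
  qed
  then show ?thesis
    unfolding quotient_topology_def by (simp add: topology_inverse')
qed

lemma topspace_quotient_topology [simp]:
  "topspace (quotient_topology X q) = q ` topspace X"
proof
  have "openin (quotient_topology X q) (topspace (quotient_topology X q))"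
    by (rule openin_topspace)
  then show "topspace (quotient_topology X q) \<subseteq> q ` topspace X"
    unfolding openin_quotient_topology by (rule conjunct1)
  have "{x \<in> topspace X. q x \<in> q ` topspace X} = topspace X" by auto
  then have "openin (quotient_topology X q) (q ` topspace X)"
    unfolding openin_quotient_topology by simp
  then show "q ` topspace X \<subseteq> topspace (quotient_topology X q)"
    by (rule openin_subset)
qed

lemma quotient_map_quotient_topology: "quotient_map X (quotient_topology X q) q"
  unfolding quotient_map_def by (auto simp: openin_quotient_topology)


section \<open>Tilings of the plane\<close>

text \<open>Tiles carry labels from a finite type \<open>'l\<close>; taking \<open>'l = unit\<close> gives unlabelled tiles.\<close>

type_synonym 'l labelled = "(real ^ 2) set \<times> 'l"

definition tile :: "('l :: finite) labelled \<Rightarrow> bool" where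
  "tile t \<longleftrightarrow> compact (fst t) \<and> fst t = closure (interior (fst t))"

definition translation_equiv :: "('l :: finite) labelled rel" where
  "translation_equiv =
     {(t, u). tile t \<and> tile u \<and> snd t = snd u \<and> (\<exists>v. fst u = (+) v ` fst t)}"

definition prototiles :: "('l :: finite) labelled set set" where
  "prototiles = {t. tile t} // translation_equiv"

definition tiling_modeled_on :: "('l :: finite) labelled set set \<Rightarrow> 'l labelled set \<Rightarrow> bool" where
  "tiling_modeled_on P T \<longleftrightarrow>
     P \<subseteq> prototiles \<and> T \<subseteq> \<Union>P \<and> \<Union>(fst ` T) = UNIV \<and>
     pairwise (\<lambda>t u. interior (fst t) \<inter> interior (fst u) = {}) T"

fun polyline :: "'a :: real_normed_vector list \<Rightarrow> real \<Rightarrow> 'a" where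
  "polyline [] = linepath 0 0"
| "polyline [a] = linepath a a"
| "polyline [a, b] = linepath a b"
| "polyline (a # b # c # xs) = linepath a b +++ polyline (b # c # xs)"

text \<open>A polygon is a simple closed polygonal curve together with its inside; it need not be
  convex. Degenerate vertex lists are excluded by simplicity of the curve.\<close>

definition polygon :: "(real ^ 2) set \<Rightarrow> bool" where
  "polygon S \<longleftrightarrow>
     (\<exists>a vs. simple_path (polyline (a # vs @ [a])) \<and>
        S = path_image (polyline (a # vs @ [a])) \<union> inside (path_image (polyline (a # vs @ [a]))))"

definition polygonal_tiling :: "('l :: finite) labelled set set \<Rightarrow> 'l labelled set \<Rightarrow> bool" where
  "polygonal_tiling P T \<longleftrightarrow> tiling_modeled_on P T \<and> (\<forall>t\<in>T. polygon (fst t))"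


section \<open>The complex defined by a tiling, and geometric realizations\<close>

definition branch_points :: "('l :: finite) labelled set \<Rightarrow> (real ^ 2) set" where
  "branch_points T = {v. \<exists>S. S \<subseteq> {t \<in> T. v \<in> fst t} \<and> card S = 3}"

text \<open>The tiles glued along their boundaries: a set is open iff its trace on every tile is.
  For a locally finite tiling of the plane this is the Euclidean topology.\<close>

definition tiling_topology :: "('l :: finite) labelled set \<Rightarrow> (real ^ 2) topology" where
  "tiling_topology T =
     topology (\<lambda>U. U \<subseteq> \<Union>(fst ` T) \<and> (\<forall>t\<in>T. openin (top_of_set (fst t)) (fst t \<inter> U)))"

lemma openin_tiling_topology:
  "openin (tiling_topology T) U \<longleftrightarrow>
     U \<subseteq> \<Union>(fst ` T) \<and> (\<forall>t\<in>T. openin (top_of_set (fst t)) (fst t \<inter> U))"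
proof -
  have "istopology (\<lambda>U. U \<subseteq> \<Union>(fst ` T) \<and> (\<forall>t\<in>T. openin (top_of_set (fst t)) (fst t \<inter> U)))"
    unfolding istopology_def
  proof (intro conjI allI impI ballI)
    fix S U t
    assume "S \<subseteq> \<Union>(fst ` T) \<and> (\<forall>t\<in>T. openin (top_of_set (fst t)) (fst t \<inter> S))"
      and "U \<subseteq> \<Union>(fst ` T) \<and> (\<forall>t\<in>T. openin (top_of_set (fst t)) (fst t \<inter> U))"
      and "t \<in> T"
    moreover have "fst t \<inter> (S \<inter> U) = (fst t \<inter> S) \<inter> (fst t \<inter> U)" by auto
    ultimately show "openin (top_of_set (fst t)) (fst t \<inter> (S \<inter> U))"
      by (metis openin_Int)
  next
    fix K t
    assume K: "\<forall>S\<in>K. S \<subseteq> \<Union>(fst ` T) \<and> (\<forall>t\<in>T. openin (top_of_set (fst t)) (fst t \<inter> S))"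
      and t: "t \<in> T"
    have "fst t \<inter> \<Union>K = \<Union>((\<inter>) (fst t) ` K)" by auto
    moreover have "openin (top_of_set (fst t)) (\<Union>((\<inter>) (fst t) ` K))"
      by (rule openin_Union) (use K t in blast)
    ultimately show "openin (top_of_set (fst t)) (fst t \<inter> \<Union>K)" by simp
  qed blast+
  then show ?thesis
    unfolding tiling_topology_def by (simp add: topology_inverse')
qed

text \<open>The cell structure cut out by a tiling when \<open>V\<close> is taken as the set of vertices. With
  \<open>V = branch_points T\<close> the vertices are exactly the points belonging to at least three tiles.\<close>

definition tiling_complex :: "(real ^ 2) set \<Rightarrow> ('l :: finite) labelled set \<Rightarrow> (real ^ 2) cw_structure" where
  "tiling_complex V T =
     \<lparr>cw_space = tiling_topology T,
      cells = (\<lambda>n. if n = 0 then (\<lambda>v. {v}) ` V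
                   else if n = 1 then components ((\<Union>t\<in>T. frontier (fst t)) - V)
                   else if n = 2 then (\<lambda>t. interior (fst t)) ` T
                   else {})\<rparr>"

text \<open>Vertices lying on two faces only. If only the points belonging to at least three tiles were
  vertices, no tiling could realize the complex \<open>sigma_infinity\<close> defined below: already in
  \<open>\<sigma>(C)\<close> the identifications \<open>A\<^sub>4\<^sub>5 = C\<^sub>5\<^sub>4\<close> and \<open>A\<^sub>4\<^sub>3 = C\<^sub>5\<^sub>6\<close> make \<open>A\<^sub>4 = C\<^sub>5\<close> an
  interior vertex lying on exactly two faces, and an isomorphism preserves the number of faces at a
  vertex. So the vertex set \<open>V\<close> of a realization contains all points belonging to at least three
  tiles, and may contain further boundary points, which subdivide edges. If every vertex of \<open>Y\<close>
  lies on at least three faces, then \<open>V = branch_points T\<close> is forced.\<close>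

definition geometric_realization ::
    "('l :: finite) labelled set set \<Rightarrow> 'l labelled set \<Rightarrow> 'b cw_structure \<Rightarrow> bool" where
  "geometric_realization P T Y \<longleftrightarrow>
     polygonal_tiling P T \<and>
     (\<forall>t\<in>T. fst t homeomorphic (cball 0 1 :: (real ^ 2) set)) \<and>
     (\<exists>V. branch_points T \<subseteq> V \<and> V \<subseteq> (\<Union>t\<in>T. frontier (fst t)) \<and>
          cw_isomorphic (tiling_complex V T) Y)"


section \<open>The Tribonacci topological substitution\<close>

datatype ptype = A | B | C

text \<open>Side \<open>i\<close> of \<open>X\<close> is the edge \<open>X\<^sub>i\<^sub>j\<close> with \<open>j = i + 1\<close> modulo the number of sides, oriented
  from \<open>X\<^sub>i\<close> to \<open>X\<^sub>j\<close>.\<close>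

fun nsides :: "ptype \<Rightarrow> nat" where
  "nsides A = 6" | "nsides B = 6" | "nsides C = 10"

fun sub_faces :: "ptype \<Rightarrow> ptype set" where
  "sub_faces A = {B}" | "sub_faces B = {C}" | "sub_faces C = {A, B, C}"

text \<open>Pairs of sides glued inside the patch \<open>\<sigma>(X)\<close>. No patch has two faces of the same type, so
  a face of \<open>\<sigma>(X)\<close> is named by its type. All gluings reverse the orientation of the sides; for
  instance \<open>B\<^sub>4\<^sub>5 = C\<^sub>7\<^sub>6\<close> is the pair of side 4 of \<open>B\<close> and side 6 of \<open>C\<close>.\<close>

fun sub_glue :: "ptype \<Rightarrow> ((ptype \<times> nat) \<times> (ptype \<times> nat)) set" where
  "sub_glue A = {}"
| "sub_glue B = {}"
| "sub_glue C = {((A, 4), (C, 4)), ((A, 3), (C, 5)), ((A, 2), (B, 5)), ((B, 4), (C, 6))}"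

fun sub_vertex :: "ptype \<Rightarrow> nat \<Rightarrow> ptype \<times> nat" where
  "sub_vertex A i = (B, (i + 2) mod 6)"
| "sub_vertex B i = [(C, 7), (C, 8), (C, 1), (C, 2), (C, 3), (C, 6)] ! i"
| "sub_vertex C i = [(A, 5), (A, 0), (B, 1), (B, 2), (B, 3), (B, 4), (C, 8), (C, 1), (C, 2), (C, 3)] ! i"

text \<open>The image of side \<open>i\<close> of \<open>X\<close> as the list of the sides it runs through, from \<open>\<sigma>(X\<^sub>i)\<close> to
  \<open>\<sigma>(X\<^sub>j)\<close>. Every side in the list is run through in its positive direction.\<close>

fun sub_edge :: "ptype \<Rightarrow> nat \<Rightarrow> (ptype \<times> nat) list" where
  "sub_edge A i = [(B, (i + 2) mod 6)]"
| "sub_edge B i =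
     [[(C, 7)], [(C, 8), (C, 9), (C, 0)], [(C, 1)], [(C, 2)], [(C, 3), (C, 4), (C, 5)], [(C, 6)]] ! i"
| "sub_edge C i =
     [[(A, 5)], [(A, 0), (A, 1), (B, 0)], [(B, 1)], [(B, 2)], [(B, 3)], [(C, 7)],
      [(C, 8), (C, 9), (C, 0)], [(C, 1)], [(C, 2)], [(C, 3)]] ! i"

text \<open>Consistency of the two tables: modulo the identification of vertices in \<open>\<sigma>(X)\<close>, the image
  of a side is an edge path from the image of its origin to the image of its end.\<close>

definition side_end :: "ptype \<times> nat \<Rightarrow> ptype \<times> nat" where
  "side_end e = (fst e, (snd e + 1) mod nsides (fst e))"

definition same_vertex :: "ptype \<Rightarrow> ptype \<times> nat \<Rightarrow> ptype \<times> nat \<Rightarrow> bool" where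
  "same_vertex X =
     equivclp (\<lambda>v w. \<exists>(e, e') \<in> sub_glue X. (v, w) = (e, side_end e') \<or> (v, w) = (side_end e, e'))"

lemma same_vertex_refl: "same_vertex X v v"
  by (simp add: same_vertex_def)

lemma same_vertex_sym: "same_vertex X v w \<Longrightarrow> same_vertex X w v"
  unfolding same_vertex_def by (rule equivclp_sym)

lemma same_vertex_glue:
  assumes "(e, e') \<in> sub_glue X"
  shows "same_vertex X e (side_end e')" and "same_vertex X (side_end e) e'"
  unfolding same_vertex_def by (rule r_into_equivclp, use assms in blast)+

lemma same_vertex_C:
  "same_vertex C (A, 2) (B, 0)" "same_vertex C (A, 5) (C, 4)" "same_vertex C (B, 4) (C, 7)"
  using same_vertex_glue(1)[of "(A, 2)" "(B, 5)" C] same_vertex_glue(2)[of "(A, 4)" "(C, 4)" C]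
    same_vertex_glue(1)[of "(B, 4)" "(C, 6)" C]
  by (simp_all add: side_end_def)

lemma sub_edge_path:
  assumes "i < nsides X"
  shows "same_vertex X (sub_vertex X i) (hd (sub_edge X i)) \<and>
     successively (\<lambda>e e'. same_vertex X (side_end e) e') (sub_edge X i) \<and>
     same_vertex X (side_end (last (sub_edge X i))) (sub_vertex X ((i + 1) mod nsides X))"
proof -
  consider "X = A" | "X = B" | "X = C" by (cases X)
  then have "(X, i) \<in> set (map (Pair A) [0,1,2,3,4,5] @ map (Pair B) [0,1,2,3,4,5] @
      map (Pair C) [0,1,2,3,4,5,6,7,8,9])"
    by cases (use assms in simp_all, presburger+)
  then show ?thesis
    unfolding set_append set_map list.set
    by (elim UnE imageE insertE emptyE;
        simp add: side_end_def same_vertex_refl same_vertex_C same_vertex_C[THEN same_vertex_sym]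
          flip: numeral_2_eq_2)
qed


section \<open>Iteration\<close>

text \<open>A face of \<open>\<sigma>\<^sup>k(C)\<close> is determined by its type and by the types of its ancestors in
  \<open>\<sigma>\<^sup>k\<^sup>-\<^sup>1(C), \<dots>, \<sigma>\<^sup>0(C) = C\<close>. It is encoded by the sequence \<open>f\<close> with \<open>f 0\<close> its own type, \<open>f n\<close>
  the type of its \<open>n\<close>-th ancestor for \<open>n \<le> k\<close>, and \<open>f n = C\<close> for \<open>n \<ge> k\<close>. Continuing the sequence
  by \<open>C\<close> implements the identification of \<open>C\<close> with the face of type \<open>C\<close> in \<open>\<sigma>(C)\<close>:
  \<open>\<sigma>\<^sup>k(C)\<close> is literally contained in \<open>\<sigma>\<^sup>k\<^sup>+\<^sup>1(C)\<close>, see \<open>patch_mono\<close>.\<close>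

type_synonym face = "nat \<Rightarrow> ptype"

definition child :: "face \<Rightarrow> ptype \<Rightarrow> face" where
  "child f X = case_nat X f"

text \<open>A polygonal complex is given by its faces and the pairs of sides that are glued, always
  with reversal of orientation.\<close>

type_synonym gluing_scheme = "face set \<times> ((face \<times> nat) \<times> (face \<times> nat)) set"

definition inflate :: "gluing_scheme \<Rightarrow> gluing_scheme" where
  "inflate S =
     ({child f X | f X. f \<in> fst S \<and> X \<in> sub_faces (f 0)},
      {((child f X, i), (child f Y, j)) | f X i Y j.
         f \<in> fst S \<and> ((X, i), (Y, j)) \<in> sub_glue (f 0)} \<union>
      {((child f X, i), (child g Y, j)) | f a g b X i Y j.
         ((f, a), (g, b)) \<in> snd S \<and>
         ((X, i), (Y, j)) \<in> set (zip (sub_edge (f 0) a) (rev (sub_edge (g 0) b)))})"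

definition patch :: "nat \<Rightarrow> gluing_scheme" where
  "patch k = (inflate ^^ k) ({\<lambda>_. C}, {})"

definition patch_limit :: gluing_scheme where
  "patch_limit = ((\<Union>k. fst (patch k)), (\<Union>k. snd (patch k)))"

lemma child_const_C: "child (\<lambda>_. C) C = (\<lambda>_. C)"
  by (auto simp: child_def split: nat.split)

lemma inflate_mono:
  assumes "fst S \<subseteq> fst S'" "snd S \<subseteq> snd S'"
  shows "fst (inflate S) \<subseteq> fst (inflate S') \<and> snd (inflate S) \<subseteq> snd (inflate S')"
proof -
  have *: "f \<in> fst S \<Longrightarrow> f \<in> fst S'" "e \<in> snd S \<Longrightarrow> e \<in> snd S'" for f e
    using assms by auto
  show ?thesis
    unfolding inflate_def fst_conv snd_conv
    by (intro conjI Un_mono Collect_mono impI; elim exE conjE; intro exI conjI; (assumption | erule *))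
qed

lemma patch_mono:
  "fst (patch k) \<subseteq> fst (patch (Suc k)) \<and> snd (patch k) \<subseteq> snd (patch (Suc k))"
proof (induction k)
  case 0
  have "child (\<lambda>_. C) C \<in> fst (inflate ({\<lambda>_. C}, {}))"
    by (auto simp: inflate_def)
  then show ?case by (simp add: patch_def child_const_C)
next
  case (Suc k)
  then show ?case
    using inflate_mono[of "patch k" "patch (Suc k)"] by (simp add: patch_def)
qed


section \<open>The complex \<open>\<sigma>\<^sup>\<infinity>(C)\<close>\<close>

text \<open>Each face is a copy of the closed unit disc whose boundary circle is cut into sides by the
  roots of unity; \<open>side_point X i 0\<close> is the vertex \<open>X\<^sub>i\<close>.\<close>

definition side_point :: "ptype \<Rightarrow> nat \<Rightarrow> real \<Rightarrow> complex" where
  "side_point X i s = cis (2 * pi * (real i + s) / real (nsides X))"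

inductive glued :: "gluing_scheme \<Rightarrow> face \<times> complex \<Rightarrow> face \<times> complex \<Rightarrow> bool"
  for S :: gluing_scheme where
  "((f, i), (g, j)) \<in> snd S \<Longrightarrow> 0 \<le> s \<Longrightarrow> s \<le> 1 \<Longrightarrow>
     glued S (f, side_point (f 0) i s) (g, side_point (g 0) j (1 - s))"

definition glue_class :: "gluing_scheme \<Rightarrow> face \<times> complex \<Rightarrow> (face \<times> complex) set" where
  "glue_class S x = {y. equivclp (glued S) x y}"

definition glued_complex :: "gluing_scheme \<Rightarrow> (face \<times> complex) set cw_structure" where
  "glued_complex S =
     \<lparr>cw_space = quotient_topology (sum_topology (\<lambda>_. top_of_set (cball 0 1)) (fst S)) (glue_class S),
      cells = (\<lambda>n.
        if n = 0 then {{glue_class S (f, side_point (f 0) i 0)} | f i. f \<in> fst S \<and> i < nsides (f 0)}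
        else if n = 1 then
          {glue_class S ` ({f} \<times> side_point (f 0) i ` {0<..<1}) | f i. f \<in> fst S \<and> i < nsides (f 0)}
        else if n = 2 then {glue_class S ` ({f} \<times> ball 0 1) | f. f \<in> fst S}
        else {})\<rparr>"

definition sigma_infinity :: "(face \<times> complex) set cw_structure" where
  "sigma_infinity = glued_complex patch_limit"

end

theory Submission
  imports Defs
begin

text \<open>The complex is realized by the hexagonal honeycomb in which certain pairs of adjacent cells are
  merged: faces of type \<open>A\<close> and \<open>B\<close> are single hexagons, the decagon \<open>C\<close> is a pair of them. Let
  \<open>e\<^sup>3 + e\<^sup>2 + e = 1\<close>. A face gets a position in \<open>\<int>[e]\<close>, which the passage to a child multiplies by
  \<open>e\<close> and translates; the relative positions of glued faces then form a finite set. The cells have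
  centres in \<open>\<int>[e] / \<int>(1 + e + e\<^sup>2)\<close>, a lattice of rank two. Real values of positions lie in disjoint
  intervals of total length \<open>1 + e + e\<^sup>2\<close> according to the type, and the interval determines the
  parent, so distinct faces own distinct cells. Every side is glued, so the set of owned cells is
  closed under passing to neighbours and exhausts the honeycomb. Finally, a common point of two
  tiles lies on a common edge of two cells, hence on a pair of glued sides; thus the realization map
  has exactly the fibres of the gluing.\<close>

section \<open>Topological preliminaries\<close>

text \<open>The number \<open>1/e\<close> is the Tribonacci constant, the growth rate of the number
  of faces. Interval lengths a, b, c for the three types must satisfy c = e (b + c), b = e (c + a),
  a = e c: on the right of each equation stand the possible parents of the type. The cubic for
  \<open>e\<close> is the condition for a positive solution, and a = \<open>e\<^sup>2\<close>, b =
  \<open>1 - e\<close>, c = \<open>e\<close> is the one used. The obstacle is global: infinitely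
  many faces have to fit into the plane without overlaps and without gaps, while the outlines of the
  patches become ever more complicated. These outlines never enter. Overlaps are excluded by the
  real value alone, which acts as the internal coordinate of a cut and project scheme with
  \<open>project\<close> giving the place in the plane. Gaps are excluded by walking from cell to
  cell. All that concerns shapes is checked on the finite table of glued pairs. A decagon has 6 + 6
  - 2 sides because the common edge of its two hexagons is suppressed. The two ends of this edge are
  the vertices that lie on only two faces; they force a vertex set larger than
  \<open>branch_points\<close>.\<close>

lemma homeomorphism_of_compact_families:
  fixes p :: "'i \<Rightarrow> 'a::topological_space \<Rightarrow> 'b::t2_space" and q :: "'i \<Rightarrow> 'a \<Rightarrow> 'c::t2_space"
  assumes "finite I" "compact K"
    and p: "\<And>i. i \<in> I \<Longrightarrow> continuous_on K (p i)" and q: "\<And>i. i \<in> I \<Longrightarrow> continuous_on K (q i)"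
    and pq: "\<And>i j x y. i \<in> I \<Longrightarrow> j \<in> I \<Longrightarrow> x \<in> K \<Longrightarrow> y \<in> K \<Longrightarrow> p i x = p j y \<longleftrightarrow> q i x = q j y"
  obtains h where "continuous_on (\<Union>i\<in>I. p i ` K) h" "inj_on h (\<Union>i\<in>I. p i ` K)"
    "\<And>i x. i \<in> I \<Longrightarrow> x \<in> K \<Longrightarrow> h (p i x) = q i x"
proof -
  let ?D = "\<Union>i\<in>I. p i ` K"
  have "\<exists>h. \<forall>i x. i \<in> I \<longrightarrow> x \<in> K \<longrightarrow> h (p i x) = q i x"
  proof -
    define c where "c z = (SOME (i, x). i \<in> I \<and> x \<in> K \<and> p i x = z)" for z
    define h where "h z = (case c z of (i, x) \<Rightarrow> q i x)" for z
    have "h (p i x) = q i x" if ix: "i \<in> I" "x \<in> K" for i x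
    proof -
      obtain j y where jy: "c (p i x) = (j, y)" by fastforce
      have "case c (p i x) of (j, y) \<Rightarrow> j \<in> I \<and> y \<in> K \<and> p j y = p i x"
        unfolding c_def by (rule someI[where x = "(i, x)"]) (use ix in auto)
      then show ?thesis using pq[of j i y x] ix by (simp add: h_def jy)
    qed
    then show ?thesis by blast
  qed
  then obtain h where h: "\<And>i x. i \<in> I \<Longrightarrow> x \<in> K \<Longrightarrow> h (p i x) = q i x" by blast
  \<comment> \<open>The preimage of a closed set is made up of finitely many compact images, hence
    is closed. This gives continuity of \<open>h\<close>, of which only the composites with the
    \<open>p i\<close> are known.\<close>
  have cont: "continuous_on ?D h"
    unfolding continuous_on_closed_invariant
  proof (intro allI impI)
    fix S :: "'c set" assume S: "closed S"
    let ?R = "\<Union>i\<in>I. p i ` {x \<in> K. q i x \<in> S}"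
    have "compact {x \<in> K. q i x \<in> S}" if "i \<in> I" for i
    proof -
      have "closedin (top_of_set K) (K \<inter> q i -` S)"
        using q[OF that] S continuous_on_closed_vimage continuous_closedin_preimage by blast
      then have "compact (K \<inter> q i -` S)"
        using \<open>compact K\<close> closedin_compact by blast
      moreover have "K \<inter> q i -` S = {x \<in> K. q i x \<in> S}" by auto
      ultimately show ?thesis by simp
    qed
    then have "compact ?R"
      using \<open>finite I\<close> p by (intro compact_UN compact_continuous_image)
        (auto intro: continuous_on_subset)
    moreover have "?R \<inter> ?D = h -` S \<inter> ?D" using h by auto
    ultimately show "\<exists>A. closed A \<and> A \<inter> ?D = h -` S \<inter> ?D"
      using compact_imp_closed by blast
  qed
  have inj: "inj_on h ?D"
    using pq h by (auto simp: inj_on_def)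
  show ?thesis using that[OF cont inj h] .
qed

text \<open>The complement of a piece is the union of the other pieces, so each piece is also closed
  in \<open>U\<close> and no connected subset of \<open>U\<close> can properly contain it.\<close>

lemma connected_open_partition_components:
  assumes "\<Union>\<E> = U" and "\<And>E. E \<in> \<E> \<Longrightarrow> connected E \<and> E \<noteq> {} \<and> openin (top_of_set U) E"
    and disj: "\<And>E E'. E \<in> \<E> \<Longrightarrow> E' \<in> \<E> \<Longrightarrow> E \<inter> E' \<noteq> {} \<Longrightarrow> E = E'"
  shows "components U = \<E>"
proof -
  have max: "E = D" if E: "E \<in> \<E>" and D: "connected D" "E \<subseteq> D" "D \<subseteq> U" for E D
  proof -
    have "U - E = \<Union>(\<E> - {E})"
      using assms(1) disj[OF E] E by blast
    moreover have "openin (top_of_set U) (\<Union>(\<E> - {E}))"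
      by (rule openin_Union) (use assms(2) in blast)
    ultimately have "closedin (top_of_set U) E"
      using assms(1) E by (metis Sup_upper closedin_def double_diff dual_order.refl topspace_euclidean_subtopology)
    then have "openin (top_of_set D) E" "closedin (top_of_set D) E"
      using D assms(2)[OF E] openin_subset_trans closedin_subset_trans by blast+
    then show ?thesis
      using D(1) assms(2)[OF E] unfolding connected_clopen by blast
  qed
  have E: "E \<in> components U" if "E \<in> \<E>" for E
    unfolding in_components_maximal
    using assms that max by (intro conjI allI impI) blast+
  moreover have "D \<in> \<E>" if D: "D \<in> components U" for D
  proof -
    obtain x where "x \<in> D" "x \<in> U"
      using D in_components_nonempty in_components_subset by blast
    then obtain E' where "E' \<in> \<E>" "x \<in> E'" using assms(1) by blast
    then show ?thesis
      using components_nonoverlap[OF D E[of E']] \<open>x \<in> D\<close> by blast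
  qed
  ultimately show ?thesis by blast
qed

text \<open>The complement of \<open>S\<close> is connected and unbounded, so nothing outside
  \<open>S\<close> can be enclosed by the frontier. This turns a compact disc into the form curve
  plus inside that \<open>polygon\<close> asks for.\<close>

lemma inside_frontier_compact:
  fixes S :: "'a::euclidean_space set"
  assumes "compact S" "connected (- S)" "2 \<le> DIM('a)"
  shows "S = frontier S \<union> inside (frontier S)"
proof -
  have "\<not> bounded (- S)"
    using assms(1) compact_imp_bounded bounded_Un[of S "- S"]
    by (metis Compl_partition not_bounded_UNIV)
  moreover have "interior S \<union> - S = - frontier S"
    using assms(1) by (auto simp: frontier_def compact_imp_closed dest: subsetD[OF interior_subset])
  ultimately have "inside (frontier S) \<subseteq> interior S"
    using inside_subset[OF assms(2)] by blast
  moreover have "interior S \<subseteq> inside (frontier S)"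
    using interior_inside_frontier assms(1) compact_imp_bounded by blast
  ultimately have "inside (frontier S) = interior S" by blast
  then show ?thesis
    using assms(1) interior_subset[of S] by (auto simp: frontier_def compact_imp_closed)
qed

text \<open>Invariance of domain is used twice: for \<open>h\<close> on the open ball, and for its
  inverse on the interior of the image, which keeps interior points away from the sphere.\<close>

lemma disc_image:
  fixes h :: "'a::euclidean_space \<Rightarrow> 'b::euclidean_space"
  assumes cont: "continuous_on (cball 0 1) h" and inj: "inj_on h (cball 0 1)"
    and dim: "DIM('a) = DIM('b)"
  shows "interior (h ` cball 0 1) = h ` ball 0 1" and "frontier (h ` cball 0 1) = h ` sphere 0 1"
    and "closure (interior (h ` cball 0 1)) = h ` cball 0 1"
proof -
  let ?S = "h ` cball 0 1"
  have compact: "compact ?S" using cont by (simp add: compact_continuous_image)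
  obtain g where g: "homeomorphism (cball 0 1) ?S h g"
    using homeomorphism_compact[OF _ cont refl inj] by auto
  have "open (h ` ball 0 1)"
    by (rule invariance_of_domain_gen)
      (use cont inj dim in \<open>auto intro: continuous_on_subset inj_on_subset\<close>)
  then have 1: "h ` ball 0 1 \<subseteq> interior ?S"
    by (intro interior_maximal) auto
  have sub: "interior ?S \<subseteq> ?S" by (rule interior_subset)
  have hg: "h (g y) = y" "g y \<in> cball 0 1" if "y \<in> ?S" for y
    using g that unfolding homeomorphism_def by auto
  have "continuous_on (interior ?S) g"
    by (rule continuous_on_subset[OF homeomorphism_cont2[OF g] sub])
  moreover have "inj_on g (interior ?S)"
    using hg(1) sub by (metis inj_onI subsetD)
  ultimately have "open (g ` interior ?S)"
    by (intro invariance_of_domain_gen) (simp_all add: dim)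
  moreover have "g ` interior ?S \<subseteq> cball 0 1" using hg(2) sub by auto
  ultimately have "g ` interior ?S \<subseteq> ball 0 1"
    using interior_maximal[of "g ` interior ?S" "cball 0 1"] by simp
  then have 2: "interior ?S \<subseteq> h ` ball 0 1"
    using hg(1) sub by (intro subsetI rev_image_eqI) auto
  show int: "interior ?S = h ` ball 0 1" using 1 2 by blast
  have "frontier ?S = ?S - h ` ball 0 1"
    using compact int by (simp add: frontier_def compact_imp_closed)
  also have "\<dots> = h ` (cball 0 1 - ball 0 1)"
    using inj_on_image_set_diff[OF inj, of "cball 0 1" "ball 0 1"] by auto
  also have "cball 0 1 - ball 0 1 = sphere (0::'a) 1" by auto
  finally show "frontier ?S = h ` sphere 0 1" .
  have "h ` closure (ball 0 1) \<subseteq> closure (h ` ball 0 1)"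
    by (rule image_closure_subset) (simp_all add: cont closure_subset)
  then show "closure (interior ?S) = ?S"
    unfolding int using compact closure_minimal[of "h ` ball 0 1" ?S] image_mono[of "ball 0 1" "cball 0 1" h]
    by (simp add: compact_imp_closed subset_antisym)
qed

text \<open>Both the plane with its tiles and the glued complex will be quotients of the same
  disjoint union of discs; equal fibres then give the homeomorphism for free.\<close>

lemma quotient_maps_same_fibres:
  assumes p: "quotient_map X Y p" and q: "quotient_map X Z q"
    and fib: "\<And>x y. x \<in> topspace X \<Longrightarrow> y \<in> topspace X \<Longrightarrow> p x = p y \<longleftrightarrow> q x = q y"
  obtains h where "homeomorphic_map Y Z h" "\<And>x. x \<in> topspace X \<Longrightarrow> h (p x) = q x"
proof -
  define h where "h y = q (SOME x. x \<in> topspace X \<and> p x = y)" for y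
  have h: "h (p x) = q x" if "x \<in> topspace X" for x
  proof -
    let ?x = "SOME x'. x' \<in> topspace X \<and> p x' = p x"
    have "?x \<in> topspace X \<and> p ?x = p x"
      by (rule someI) (use that in simp)
    then show ?thesis using fib[of ?x x] that by (simp add: h_def)
  qed
  have "quotient_map X Z (h \<circ> p)"
    using q by (rule quotient_map_eq) (simp add: h)
  then have "quotient_map Y Z h"
    using quotient_map_compose_eq[OF p] by blast
  moreover have "inj_on h (topspace Y)"
    unfolding quotient_imp_surjective_map[OF p, symmetric] using fib by (auto simp: inj_on_def h)
  ultimately show ?thesis
    using that h by (simp add: homeomorphic_map_def)
qed


section \<open>Closed polygonal curves\<close>

lemma pathstart_polyline [simp]: "pathstart (polyline (a # xs)) = a"
  by (induction "a # xs" arbitrary: a xs rule: polyline.induct) auto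

lemma pathfinish_polyline [simp]: "xs \<noteq> [] \<Longrightarrow> pathfinish (polyline xs) = last xs"
  by (induction xs rule: polyline.induct) auto

lemma pathstart_polyline_upt [simp]:
  "i \<le> m \<Longrightarrow> pathstart (polyline (map v [i..<Suc m])) = v i"
  by (simp add: upt_conv_Cons del: upt_Suc)

lemma polyline_map_upt:
  assumes "Suc i < m"
  shows "polyline (map v [i..<Suc m]) = linepath (v i) (v (Suc i)) +++ polyline (map v [Suc i..<Suc m])"
  using assms by (simp add: upt_conv_Cons del: upt_Suc)

lemma path_image_polyline:
  assumes "i < m"
  shows "path_image (polyline (map v [i..<Suc m])) = (\<Union>k\<in>{i..<m}. closed_segment (v k) (v (Suc k)))"
  using assms
proof (induction "m - i" arbitrary: i)
  case (Suc d)
  show ?case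
  proof (cases "Suc i = m")
    case True
    then show ?thesis by (auto simp: upt_conv_Cons simp del: upt_Suc)
  next
    case False
    then have lt: "Suc i < m" using Suc by simp
    have "path_image (polyline (map v [i..<Suc m])) =
        closed_segment (v i) (v (Suc i)) \<union> path_image (polyline (map v [Suc i..<Suc m]))"
      unfolding polyline_map_upt[OF lt] by (subst path_image_join) (use lt in \<open>simp_all del: upt_Suc\<close>)
    also have "\<dots> = closed_segment (v i) (v (Suc i)) \<union> (\<Union>k\<in>{Suc i..<m}. closed_segment (v k) (v (Suc k)))"
      using Suc.hyps(1)[of "Suc i"] Suc.hyps(2) lt by simp
    also have "\<dots> = (\<Union>k\<in>insert i {Suc i..<m}. closed_segment (v k) (v (Suc k)))" by simp
    also have "insert i {Suc i..<m} = {i..<m}" using Suc.prems by auto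
    finally show ?thesis .
  qed
qed simp

lemma arc_polyline:
  assumes "i < m" and "\<And>k. i \<le> k \<Longrightarrow> k < m \<Longrightarrow> v k \<noteq> v (Suc k)"
    and "\<And>k l. i \<le> k \<Longrightarrow> k < l \<Longrightarrow> l < m \<Longrightarrow>
      closed_segment (v k) (v (Suc k)) \<inter> closed_segment (v l) (v (Suc l)) \<subseteq> {v (Suc k)}"
  shows "arc (polyline (map v [i..<Suc m]))"
  using assms
proof (induction "m - i" arbitrary: i)
  case (Suc d)
  show ?case
  proof (cases "Suc i = m")
    case True
    then show ?thesis using Suc.prems(2)[of i] by (auto simp: upt_conv_Cons simp del: upt_Suc)
  next
    case False
    then have lt: "Suc i < m" using Suc by simp
    show ?thesis
      unfolding polyline_map_upt[OF lt]
    proof (rule arc_join)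
      show "arc (linepath (v i) (v (Suc i)))" using Suc.prems(1,2) by simp
      show "arc (polyline (map v [Suc i..<Suc m]))"
        by (rule Suc.hyps(1)) (use Suc.hyps(2) Suc.prems lt in auto)
      show "pathfinish (linepath (v i) (v (Suc i))) = pathstart (polyline (map v [Suc i..<Suc m]))"
        using lt by (simp del: upt_Suc)
      show "path_image (linepath (v i) (v (Suc i))) \<inter> path_image (polyline (map v [Suc i..<Suc m]))
          \<subseteq> {pathstart (polyline (map v [Suc i..<Suc m]))}"
      proof -
        have "closed_segment (v i) (v (Suc i)) \<inter> closed_segment (v k) (v (Suc k)) \<subseteq> {v (Suc i)}"
          if "k \<in> {Suc i..<m}" for k
          using Suc.prems(3)[of i k] that by simp
        then show ?thesis
          unfolding path_image_polyline[OF lt] pathstart_polyline_upt[OF less_imp_le[OF lt]]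
            path_image_linepath by blast
      qed
    qed
  qed
qed simp

text \<open>The first edge is an arc, the remaining edges form an arc, and the two meet only in
  their ends. The first and the last edge are exempt from the general intersection condition,
  because they meet in the closing point \<open>v 0\<close> and not in
  \<open>v (Suc 0)\<close>.\<close>

lemma simple_path_polyline:
  assumes "3 \<le> m" "v m = v 0" and "\<And>k. k < m \<Longrightarrow> v k \<noteq> v (Suc k)"
    and "\<And>k l. k < l \<Longrightarrow> l < m \<Longrightarrow> 0 < k \<or> Suc l < m \<Longrightarrow>
      closed_segment (v k) (v (Suc k)) \<inter> closed_segment (v l) (v (Suc l)) \<subseteq> {v (Suc k)}"
    and "closed_segment (v 0) (v 1) \<inter> closed_segment (v (m - 1)) (v m) \<subseteq> {v 0}"
  shows "simple_path (polyline (map v [0..<Suc m]))"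
proof -
  have lt: "Suc 0 < m" using assms(1) by simp
  show ?thesis
    unfolding polyline_map_upt[OF lt]
  proof (rule simple_path_join_loop)
    show "arc (linepath (v 0) (v (Suc 0)))" using assms(1,3) by simp
    show "arc (polyline (map v [Suc 0..<Suc m]))"
      by (rule arc_polyline) (use assms lt in auto)
    show "pathfinish (linepath (v 0) (v (Suc 0))) = pathstart (polyline (map v [Suc 0..<Suc m]))"
      using lt by (simp del: upt_Suc)
    show "pathfinish (polyline (map v [Suc 0..<Suc m])) = pathstart (linepath (v 0) (v (Suc 0)))"
      using assms(1,2) by (simp add: last_map)
    have "closed_segment (v 0) (v (Suc 0)) \<inter> closed_segment (v k) (v (Suc k)) \<subseteq> {v 0, v (Suc 0)}"
      if "k \<in> {Suc 0..<m}" for k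
      using assms(4)[of 0 k] assms(5) that by (cases "Suc k = m") auto
    then show "path_image (linepath (v 0) (v (Suc 0))) \<inter> path_image (polyline (map v [Suc 0..<Suc m]))
        \<subseteq> {pathstart (linepath (v 0) (v (Suc 0))), pathstart (polyline (map v [Suc 0..<Suc m]))}"
      unfolding path_image_polyline[OF lt] pathstart_polyline_upt[OF less_imp_le[OF lt]]
        path_image_linepath pathstart_linepath by blast
  qed
qed


section \<open>Faces and their lattice positions\<close>

abbreviation faces :: "face set" where "faces \<equiv> fst patch_limit"

abbreviation glued_sides :: "((face \<times> nat) \<times> (face \<times> nat)) set" where
  "glued_sides \<equiv> snd patch_limit"

lemma child_simps [simp]: "child f X 0 = X" "child f X (Suc n) = f n"
  by (simp_all add: child_def)

lemma patch_Suc: "patch (Suc k) = inflate (patch k)"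
  by (simp add: patch_def)

lemma const_C_in_faces: "(\<lambda>_. C) \<in> faces"
  unfolding patch_limit_def by (auto simp: patch_def intro!: exI[of _ 0])

lemma child_in_faces:
  assumes "f \<in> faces" "X \<in> sub_faces (f 0)"
  shows "child f X \<in> faces"
proof -
  obtain k where "f \<in> fst (patch k)"
    using assms(1) by (auto simp: patch_limit_def)
  then have "child f X \<in> fst (patch (Suc k))"
    using assms(2) by (auto simp: patch_Suc inflate_def)
  then show ?thesis
    unfolding patch_limit_def fst_conv by blast
qed

lemma glued_sides_inner:
  assumes "f \<in> faces" "((X, i), (Y, j)) \<in> sub_glue (f 0)"
  shows "((child f X, i), (child f Y, j)) \<in> glued_sides"
proof -
  obtain k where "f \<in> fst (patch k)"
    using assms(1) by (auto simp: patch_limit_def)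
  then have "((child f X, i), (child f Y, j)) \<in> snd (patch (Suc k))"
    unfolding patch_Suc inflate_def snd_conv using assms(2) by blast
  then show ?thesis
    unfolding patch_limit_def snd_conv by blast
qed

lemma glued_sides_inherited:
  assumes "((f, a), (g, b)) \<in> glued_sides"
    and "((X, i), (Y, j)) \<in> set (zip (sub_edge (f 0) a) (rev (sub_edge (g 0) b)))"
  shows "((child f X, i), (child g Y, j)) \<in> glued_sides"
proof -
  obtain k where "((f, a), (g, b)) \<in> snd (patch k)"
    using assms(1) by (auto simp: patch_limit_def)
  then have "((child f X, i), (child g Y, j)) \<in> snd (patch (Suc k))"
    unfolding patch_Suc inflate_def snd_conv using assms(2) by blast
  then show ?thesis
    unfolding patch_limit_def snd_conv by blast
qed

lemma faces_induct [consumes 1, case_names const child]: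
  assumes "f \<in> faces" and "P (\<lambda>_. C)"
    and "\<And>f X. f \<in> faces \<Longrightarrow> P f \<Longrightarrow> X \<in> sub_faces (f 0) \<Longrightarrow> P (child f X)"
  shows "P f"
proof -
  have "\<forall>f\<in>fst (patch k). P f" for k
  proof (induction k)
    case 0
    then show ?case using assms(2) by (simp add: patch_def)
  next
    case (Suc k)
    have "fst (patch k) \<subseteq> faces" by (auto simp: patch_limit_def)
    then show ?case
      using Suc assms(3) by (auto simp: patch_Suc inflate_def)
  qed
  then show ?thesis using assms(1) by (auto simp: patch_limit_def)
qed

lemma glued_sides_induct [consumes 1, case_names inner inherited]:
  assumes "((f, i), (g, j)) \<in> glued_sides"
    and "\<And>f X i Y j. f \<in> faces \<Longrightarrow> ((X, i), (Y, j)) \<in> sub_glue (f 0) \<Longrightarrow>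
           P (child f X) i (child f Y) j"
    and "\<And>f a g b X i Y j. ((f, a), (g, b)) \<in> glued_sides \<Longrightarrow> P f a g b \<Longrightarrow>
           ((X, i), (Y, j)) \<in> set (zip (sub_edge (f 0) a) (rev (sub_edge (g 0) b))) \<Longrightarrow>
           P (child f X) i (child g Y) j"
  shows "P f i g j"
proof -
  have "\<forall>f i g j. ((f, i), (g, j)) \<in> snd (patch k) \<longrightarrow> P f i g j" for k
  proof (induction k)
    case 0
    then show ?case by (simp add: patch_def)
  next
    case (Suc k)
    have *: "fst (patch k) \<subseteq> faces" "snd (patch k) \<subseteq> glued_sides"
      by (auto simp: patch_limit_def)
    show ?case
    proof (intro allI impI)
      fix f' i g' j assume "((f', i), (g', j)) \<in> snd (patch (Suc k))"
      then consider (1) f X Y where "f' = child f X" "g' = child f Y" "f \<in> fst (patch k)"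
          "((X, i), (Y, j)) \<in> sub_glue (f 0)"
        | (2) f X a g b Y where "f' = child f X" "g' = child g Y" "((f, a), (g, b)) \<in> snd (patch k)"
          "((X, i), (Y, j)) \<in> set (zip (sub_edge (f 0) a) (rev (sub_edge (g 0) b)))"
        unfolding patch_Suc inflate_def snd_conv by blast
      then show "P f' i g' j"
      proof cases
        case 1
        then show ?thesis using assms(2) * by blast
      next
        case 2
        then show ?thesis using assms(3) Suc * by blast
      qed
    qed
  qed
  then show ?thesis using assms(1) by (auto simp: patch_limit_def)
qed

lemma faces_eventually_C:
  assumes "f \<in> faces"
  shows "\<exists>n. \<forall>k\<ge>n. f k = C"
  using assms
proof (induction rule: faces_induct)
  case const
  show ?case by simp
next
  case (child f X)
  then obtain n where "\<forall>k\<ge>n. f k = C" by blast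
  then have "\<forall>k\<ge>Suc n. child f X k = C"
    by (metis Suc_le_D child_simps(2) Suc_le_mono)
  then show ?case by blast
qed

section \<open>Positions of faces as expansions in powers of \<open>e\<close>\<close>

type_synonym lattice = "int \<times> int \<times> int"

text \<open>\<open>(x, y, z)\<close> stands for \<open>x + y e + z e\<^sup>2\<close>, where \<open>e\<^sup>3 + e\<^sup>2 + e = 1\<close>; \<open>times_e\<close> is
  multiplication by \<open>e\<close>.\<close>

fun times_e :: "lattice \<Rightarrow> lattice" where
  "times_e (x, y, z) = (z, x - z, y - z)"

text \<open>Only \<open>C\<close> has several children. The shifts \<open>e\<close> and
  \<open>1 + e\<close> of its children \<open>B\<close> and \<open>A\<close> are the left ends of
  the intervals later assigned to these types.\<close>

fun displacement :: "ptype \<Rightarrow> ptype \<Rightarrow> lattice" where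
  "displacement C A = (1, 1, 0)"
| "displacement C B = (0, 1, 0)"
| "displacement _ _ = (0, 0, 0)"

text \<open>Horner scheme for the sum of \<open>e^k\<close> times
  \<open>displacement (f (k + 1)) (f k)\<close> over \<open>k < n\<close>.\<close>

primrec pos_upto :: "nat \<Rightarrow> face \<Rightarrow> lattice" where
  "pos_upto 0 f = 0"
| "pos_upto (Suc n) f = times_e (pos_upto n (\<lambda>k. f (Suc k))) + displacement (f 1) (f 0)"

text \<open>The cut-off is harmless: \<open>displacement C C\<close> is zero, so all terms beyond it
  vanish.\<close>

definition position :: "face \<Rightarrow> lattice" where
  "position f = pos_upto (LEAST n. \<forall>k\<ge>n. f k = C) f"

lemma times_e_diff: "times_e (u - v) = times_e u - times_e v"
  by (cases u; cases v; simp)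

lemma times_e_0 [simp]: "times_e 0 = 0"
  by (simp add: zero_prod_def)

lemma inj_times_e: "times_e u = times_e v \<Longrightarrow> u = v"
  by (cases u; cases v; auto)

lemma pos_upto_const [simp]: "pos_upto m (\<lambda>_. C) = 0"
  by (induction m) (auto simp: zero_prod_def)

lemma pos_upto_stable:
  assumes "\<forall>k\<ge>n. f k = C" "n \<le> m"
  shows "pos_upto m f = pos_upto n f"
  using assms
proof (induction n arbitrary: m f)
  case 0
  then have "f = (\<lambda>_. C)" by auto
  then show ?case by simp
next
  case (Suc n)
  then obtain m' where m': "m = Suc m'" "n \<le> m'" by (cases m) auto
  have "pos_upto m' (\<lambda>k. f (Suc k)) = pos_upto n (\<lambda>k. f (Suc k))"
    by (rule Suc.IH) (use Suc.prems m' in auto)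
  then show ?case by (simp add: m')
qed

lemma position_eq_pos_upto:
  assumes "\<forall>k\<ge>n. f k = C"
  shows "position f = pos_upto n f"
proof -
  let ?l = "LEAST n. \<forall>k\<ge>n. f k = C"
  have "\<forall>k\<ge>?l. f k = C" by (rule LeastI) (rule assms)
  moreover have "?l \<le> n" by (rule Least_le) (rule assms)
  ultimately have "pos_upto n f = pos_upto ?l f" by (rule pos_upto_stable)
  then show ?thesis by (simp add: position_def)
qed

lemma position_const [simp]: "position (\<lambda>_. C) = 0"
  by (simp add: position_def)

lemma position_child:
  assumes "f \<in> faces"
  shows "position (child f X) = times_e (position f) + displacement (f 0) X"
proof -
  obtain n where n: "\<forall>k\<ge>n. f k = C" using faces_eventually_C[OF assms] by blast
  then have "\<forall>k\<ge>Suc n. child f X k = C"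
    by (metis Suc_le_D child_simps(2) Suc_le_mono)
  then have "position (child f X) = pos_upto (Suc n) (child f X)"
    by (rule position_eq_pos_upto)
  then show ?thesis by (simp add: position_eq_pos_upto[OF n])
qed


section \<open>Adjacent faces\<close>

text \<open>The possible types, sides and relative positions of two faces glued along a side: the
  smallest set containing the gluings inside \<open>\<sigma>(C)\<close> and closed under inflation.\<close>

definition adjacency :: "(ptype \<times> nat \<times> ptype \<times> nat \<times> lattice) set" where
  "adjacency = {
     (A, 4, C, 4, -1, -1, 0), (A, 3, C, 5, -1, -1, 0), (A, 2, B, 5, -1, 0, 0),
     (B, 4, C, 6, 0, -1, 0), (C, 3, C, 0, 0, 0, -1), (C, 4, C, 9, 0, 0, -1),
     (C, 5, C, 8, 0, 0, -1), (C, 7, C, 2, -1, 1, 1), (C, 1, B, 1, 1, -1, 0),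
     (A, 0, C, 0, -1, 0, -1), (A, 1, C, 9, -1, 0, -1), (B, 0, C, 8, 0, 0, -1),
     (B, 3, C, 3, -1, 0, 1), (C, 2, B, 2, 1, -1, -1), (B, 1, C, 1, -1, 1, 0),
     (C, 8, B, 0, 0, 0, 1), (C, 9, A, 1, 1, 0, 1), (C, 0, A, 0, 1, 0, 1),
     (A, 5, B, 2, 0, -1, -1), (C, 3, B, 3, 1, 0, -1), (B, 2, C, 2, -1, 1, 1),
     (C, 2, C, 7, 1, -1, -1), (B, 2, A, 5, 0, 1, 1), (B, 5, C, 7, 0, -1, -1),
     (C, 6, C, 1, -1, 1, 0), (B, 0, B, 3, 0, 0, -1)}"

lemma adjacency_inner:
  assumes "((X, i), (Y, j)) \<in> sub_glue Z"
  shows "(X, i, Y, j, displacement Z Y - displacement Z X) \<in> adjacency"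
  using assms by (cases Z; simp; elim disjE; simp add: adjacency_def zero_prod_def)

text \<open>Closure of the table under inflation is a finite evaluation. Absolute positions cancel:
  multiplication by \<open>e\<close> is additive, so the new difference depends only on the old one
  and on the types.\<close>

lemma adjacency_inherited:
  assumes "(X, a, Y, b, v) \<in> adjacency"
    and "((X', i), (Y', j)) \<in> set (zip (sub_edge X a) (rev (sub_edge Y b)))"
  shows "(X', i, Y', j, times_e v + displacement Y Y' - displacement X X') \<in> adjacency"
proof -
  have "\<forall>(X, a, Y, b, v)\<in>adjacency. \<forall>((X', i), (Y', j))\<in>set (zip (sub_edge X a) (rev (sub_edge Y b))).
      (X', i, Y', j, times_e v + displacement Y Y' - displacement X X') \<in> adjacency"
    by (simp add: adjacency_def zero_prod_def)
  from bspec[OF bspec[OF this assms(1), unfolded case_prod_conv] assms(2)] show ?thesis by simp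
qed

lemma adjacency_sides:
  assumes "(X, a, Y, b, v) \<in> adjacency"
  shows "a < nsides X \<and> b < nsides Y \<and> length (sub_edge X a) = length (sub_edge Y b)"
  using assms unfolding adjacency_def insert_iff empty_iff by (elim disjE) auto

lemma less_6: "(i::nat) < 6 \<longleftrightarrow> i = 0 \<or> i = 1 \<or> i = 2 \<or> i = 3 \<or> i = 4 \<or> i = 5"
  by linarith

lemma less_10: "(i::nat) < 10 \<longleftrightarrow>
    i = 0 \<or> i = 1 \<or> i = 2 \<or> i = 3 \<or> i = 4 \<or> i = 5 \<or> i = 6 \<or> i = 7 \<or> i = 8 \<or> i = 9"
  by (auto simp: numeral_eq_Suc less_Suc_eq)

lemma sub_edge_sub_faces: "i < nsides X \<Longrightarrow> (Y, j) \<in> set (sub_edge X i) \<Longrightarrow> Y \<in> sub_faces X"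
  by (cases X; simp add: less_6 less_10; elim disjE; force)

lemma sub_glue_sub_faces:
  "((X, i), (Y, j)) \<in> sub_glue Z \<Longrightarrow> X \<in> sub_faces Z \<and> Y \<in> sub_faces Z"
  by (cases Z) auto

text \<open>Induction along the way a gluing arises, inside a patch or inherited from an earlier
  gluing. From here on every statement about glued sides can be checked on the table.\<close>

lemma glued_sides_adjacency:
  assumes "((f, i), (g, j)) \<in> glued_sides"
  shows "f \<in> faces \<and> g \<in> faces \<and> (f 0, i, g 0, j, position g - position f) \<in> adjacency"
  using assms
proof (induction rule: glued_sides_induct)
  case (inner f X i Y j)
  then show ?case
    using adjacency_inner[OF inner(2)] sub_glue_sub_faces[OF inner(2)]
    by (simp add: position_child child_in_faces)
next
  case (inherited f a g b X i Y j)
  have "position (child g Y) - position (child f X) =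
      times_e (position g - position f) + displacement (g 0) Y - displacement (f 0) X"
    using inherited by (simp add: position_child times_e_diff)
  moreover have "(X, i) \<in> set (sub_edge (f 0) a)" "(Y, j) \<in> set (sub_edge (g 0) b)"
    using set_zip_leftD[OF inherited.hyps(2)] set_zip_rightD[OF inherited.hyps(2)] by simp_all
  ultimately show ?case
    using inherited adjacency_inherited[OF _ inherited.hyps(2)] adjacency_sides[of "f 0" a "g 0" b]
      child_in_faces sub_edge_sub_faces by (metis child_simps(1))
qed

section \<open>Existence of a partner for every side\<close>

definition glued_along :: "face \<Rightarrow> nat \<Rightarrow> face \<Rightarrow> nat \<Rightarrow> bool" where
  "glued_along f i g j \<longleftrightarrow> ((f, i), (g, j)) \<in> glued_sides \<or> ((g, j), (f, i)) \<in> glued_sides"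

lemma zip_member_left:
  "x \<in> set xs \<Longrightarrow> length xs = length ys \<Longrightarrow> \<exists>y. (x, y) \<in> set (zip xs ys)"
  by (metis in_set_impl_in_set_zip1)

lemma zip_rev_swap:
  assumes "(x, y) \<in> set (zip xs (rev ys))" "length xs = length ys"
  shows "(y, x) \<in> set (zip ys (rev xs))"
proof -
  have "zip (rev xs) ys = rev (zip xs (rev ys))"
    using assms(2) by (simp add: zip_rev[symmetric])
  then have "(x, y) \<in> set (zip (rev xs) ys)" using assms(1) by simp
  then show ?thesis by (auto simp: in_set_zip)
qed

lemma glued_along_inherited:
  assumes "glued_along f a g b" "(X, i) \<in> set (sub_edge (f 0) a)"
  shows "\<exists>Y j. glued_along (child f X) i (child g Y) j"
proof -
  have len: "length (sub_edge (f 0) a) = length (sub_edge (g 0) b)"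
    using assms(1) glued_sides_adjacency adjacency_sides unfolding glued_along_def by metis
  then obtain Y j where "((X, i), (Y, j)) \<in> set (zip (sub_edge (f 0) a) (rev (sub_edge (g 0) b)))"
    using zip_member_left[OF assms(2), of "rev (sub_edge (g 0) b)"] by auto
  then show ?thesis
    using assms(1) zip_rev_swap[OF _ len] glued_sides_inherited unfolding glued_along_def by metis
qed

text \<open>A side of a face of a patch is either interior to the patch or part of its boundary, and
  the boundary consists of the images of the sides of \<open>Z\<close>.\<close>

lemma sub_side_cases:
  assumes "X \<in> sub_faces Z" "i < nsides X"
  obtains Y j where "((X, i), (Y, j)) \<in> sub_glue Z \<or> ((Y, j), (X, i)) \<in> sub_glue Z"
  | a where "a < nsides Z" "(X, i) \<in> set (sub_edge Z a)"
proof -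
  have "(\<exists>Y j. ((X, i), (Y, j)) \<in> sub_glue Z \<or> ((Y, j), (X, i)) \<in> sub_glue Z) \<or>
      (\<exists>a<nsides Z. (X, i) \<in> set (sub_edge Z a))"
  proof (cases Z)
    case A
    then have "X = B" "i < 6" using assms by simp_all
    with A show ?thesis by (simp add: less_6 conj_disj_distribR ex_disj_distrib; elim disjE; simp)
  next
    case B
    then have "X = C" "i < 10" using assms by simp_all
    with B show ?thesis by (simp add: less_6 less_10 conj_disj_distribR ex_disj_distrib; elim disjE; simp)
  next
    case C
    then show ?thesis using assms(2)
      by (cases X; simp add: less_6 less_10 conj_disj_distribR ex_disj_distrib; elim disjE; simp)
  qed
  then show ?thesis using that by blast
qed

lemma glued_along_child:
  assumes "f \<in> faces" and "X \<in> sub_faces (f 0)" "i < nsides X"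
    and "\<And>a. a < nsides (f 0) \<Longrightarrow> (X, i) \<in> set (sub_edge (f 0) a) \<Longrightarrow> \<exists>g b. glued_along f a g b"
  shows "\<exists>g j. glued_along (child f X) i g j"
  using assms(2,3)
proof (cases rule: sub_side_cases)
  case (1 Y j)
  then show ?thesis using glued_sides_inner[OF assms(1)] unfolding glued_along_def by blast
next
  case (2 a)
  then show ?thesis using assms(4) glued_along_inherited by metis
qed

text \<open>For a proper child the claim is inherited from the parent. The root face is its own
  child, so there the argument would be circular and needs a separate start.\<close>

lemma every_side_glued:
  assumes "f \<in> faces" "i < nsides (f 0)"
  shows "\<exists>g j. glued_along f i g j"
proof -
  let ?c = "\<lambda>_. C"
  have step: "\<exists>g j. glued_along ?c i g j" if "i < 10"
    "\<And>a. a < 10 \<Longrightarrow> (C, i) \<in> set (sub_edge C a) \<Longrightarrow> \<exists>g b. glued_along ?c a g b" for i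
    using glued_along_child[OF const_C_in_faces, of C i] that by (simp add: child_const_C)
  have lt: "a \<in> {0,1,2,3,4,5,6,7,8,9}" if "a < 10" for a :: nat
    using that by auto
  \<comment> \<open>Sides 4, 5, 6 of \<open>C\<close> are interior to \<open>\<sigma>(C)\<close>.
    The images of sides 5 and 6 then supply 7 and 8, 9, 0, and the images of 7, 8, 9 supply 1, 2,
    3.\<close>
  have c4: "\<exists>g b. glued_along ?c a g b" if "a \<in> {4,5,6}" for a
    by (rule step) (use that in \<open>auto dest!: lt\<close>)
  have c7: "\<exists>g b. glued_along ?c 7 g b"
    by (rule step) (use c4 in \<open>auto dest!: lt\<close>)
  have c8: "\<exists>g b. glued_along ?c a g b" if "a \<in> {8,9,0}" for a
    by (rule step) (use that c4 c7 in \<open>auto dest!: lt\<close>)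
  have c1: "\<exists>g b. glued_along ?c a g b" if "a \<in> {1,2,3}" for a
    by (rule step) (use that c8 c7 in \<open>auto dest!: lt\<close>)
  have "\<forall>i<nsides (f 0). \<exists>g j. glued_along f i g j"
    using assms(1)
  proof (induction rule: faces_induct)
    case const
    show ?case using c1 c4 c7 c8 by (auto dest!: lt)
  next
    case (child f X)
    then show ?case using glued_along_child by simp
  qed
  then show ?thesis using assms(2) by blast
qed


section \<open>Cells of the honeycomb belonging to a face\<close>

lemma tribonacci_root: obtains e :: real where "0 < e" "e < 1" "e ^ 3 + e ^ 2 + e = 1"
proof -
  have "\<exists>e\<ge>0. e \<le> 1 \<and> e ^ 3 + e ^ 2 + e = (1::real)"
    by (rule IVT') (auto intro!: continuous_intros)
  then obtain e :: real where e: "0 \<le> e" "e \<le> 1" "e ^ 3 + e ^ 2 + e = 1" by blast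
  moreover have "e \<noteq> 0" "e \<noteq> 1" using e(3) by auto
  ultimately show ?thesis using that[of e] by simp
qed

text \<open>A cell is named by the centre of its hexagon. The kernel of \<open>project\<close> is spanned by
  \<open>(1, 1, 1)\<close>, whose value \<open>1 + e + e\<^sup>2\<close> is the total length of the ranges \<open>cell_range\<close>
  below; so projecting loses no information about cells.\<close>

fun cell_offsets :: "ptype \<Rightarrow> lattice set" where
  "cell_offsets C = {0, (1, 0, 0)}"
| "cell_offsets _ = {0}"

fun project :: "lattice \<Rightarrow> int \<times> int" where
  "project (x, y, z) = (x + y - 2 * z, 2 * y - x - z)"

definition face_cells :: "face \<Rightarrow> (int \<times> int) set" where
  "face_cells f = (\<lambda>v. project (position f + v)) ` cell_offsets (f 0)"

lemma project_add: "project (u + v) = project u + project v"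
  by (cases u; cases v; simp)

lemma project_diff: "project (u - v) = project u - project v"
  by (cases u; cases v; simp)

fun evaluate :: "real \<Rightarrow> lattice \<Rightarrow> real" where
  "evaluate e (x, y, z) = x + y * e + z * e\<^sup>2"

lemma evaluate_add: "evaluate e (u + v) = evaluate e u + evaluate e v"
  by (cases u; cases v; simp add: algebra_simps)

lemma evaluate_times_e:
  assumes "e ^ 3 + e ^ 2 + e = 1"
  shows "evaluate e (times_e v) = e * evaluate e v"
proof (cases v)
  case (fields x y z)
  have *: "e ^ 3 = 1 - e - e\<^sup>2" using assms by simp
  have "e * evaluate e v = x * e + y * e\<^sup>2 + z * e ^ 3"
    by (simp add: fields algebra_simps power2_eq_square power3_eq_cube)
  then show ?thesis unfolding * by (simp add: fields algebra_simps)
qed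

text \<open>The passage to a child acts on values by \<open>t \<mapsto> e t + c\<close> and maps the ranges of the possible
  parents onto disjoint pieces of the range of the child, so a face determines its parent.\<close>

fun value_range :: "real \<Rightarrow> ptype \<Rightarrow> real set" where
  "value_range e C = {0..<e}"
| "value_range e B = {e..<1}"
| "value_range e A = {1 + e..<1 + e + e\<^sup>2}"

lemma value_range_child:
  assumes e: "0 < e" "e < 1" "e ^ 3 + e ^ 2 + e = 1" and t: "t \<in> value_range e Z" "X \<in> sub_faces Z"
  shows "e * t + evaluate e (displacement Z X) \<in> value_range e X"
proof -
  define p where "p = e * t"
  have "e * (1 + e + e\<^sup>2) = 1" "e * (1 + e) = e + e\<^sup>2" "e * e = e\<^sup>2"
    using e(3) by (simp_all add: algebra_simps power2_eq_square power3_eq_cube)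
  then have p: "a \<le> t \<longleftrightarrow> e * a \<le> p" "1 + e \<le> t \<longleftrightarrow> e + e\<^sup>2 \<le> p" "e \<le> t \<longleftrightarrow> e\<^sup>2 \<le> p"
      "t < 1 + e + e\<^sup>2 \<longleftrightarrow> p < 1" for a
    using mult_le_cancel_left_pos[OF e(1), of _ t] mult_less_cancel_left_pos[OF e(1), of t]
    unfolding p_def by metis+
  have p': "t < e \<longleftrightarrow> p < e\<^sup>2" "0 \<le> t \<longleftrightarrow> 0 \<le> p" "t < 1 \<longleftrightarrow> p < e"
    using p(3) p(1)[of 0] p(1)[of 1] by auto
  have "e\<^sup>2 < e" "0 < e\<^sup>2" "0 < e ^ 3" using e(1,2) by (simp_all add: power2_eq_square)
  \<comment> \<open>With the powers of \<open>e\<close> and the product \<open>e * t\<close> treated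
    as atoms, the inclusions of intervals become linear.\<close>
  then obtain q r where q: "e\<^sup>2 = q" "e ^ 3 = r" "0 < q" "0 < r" "q < e" by simp
  then show ?thesis
    using t e q(3-) unfolding p_def[symmetric] q(1,2)
    by (cases Z; cases X) (auto simp: p(2-4)[unfolded q(1)] p'[unfolded q(1)] q(1))
qed

text \<open>The range of \<open>C\<close> splits at \<open>e\<^sup>2\<close> into the parts coming
  from parents \<open>C\<close> and \<open>B\<close>, the range of \<open>B\<close> splits at
  \<open>e + e\<^sup>2\<close> into those from \<open>C\<close> and \<open>A\<close>, and
  \<open>A\<close> has only the parent \<open>C\<close>.\<close>

lemma value_range_parent:
  assumes e: "0 < e" and t: "t \<in> value_range e Z" "X \<in> sub_faces Z"
    and t': "t' \<in> value_range e Z'" "X \<in> sub_faces Z'"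
    and eq: "e * t + evaluate e (displacement Z X) = e * t' + evaluate e (displacement Z' X)"
  shows "Z = Z'"
proof -
  define p p' q where "p = e * t" and "p' = e * t'" and "q = e * e"
  have "e * (1 + e) = e + q" by (simp add: algebra_simps q_def)
  then have "e \<le> t \<longleftrightarrow> q \<le> p" "1 + e \<le> t \<longleftrightarrow> e + q \<le> p" "e \<le> t' \<longleftrightarrow> q \<le> p'" "1 + e \<le> t' \<longleftrightarrow> e + q \<le> p'"
    using mult_le_cancel_left_pos[OF e, of e t] mult_le_cancel_left_pos[OF e, of e t']
      mult_le_cancel_left_pos[OF e, of "1 + e" t] mult_le_cancel_left_pos[OF e, of "1 + e" t']
    unfolding p_def p'_def q_def by auto
  then show ?thesis
    using t t' eq unfolding p_def[symmetric] p'_def[symmetric] by (cases Z; cases Z') auto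
qed

lemma position_range:
  assumes e: "0 < e" "e < 1" "e ^ 3 + e ^ 2 + e = 1" and "f \<in> faces"
  shows "evaluate e (position f) \<in> value_range e (f 0)"
  using assms(4)
proof (induction rule: faces_induct)
  case const
  show ?case using e(1) by (simp add: zero_prod_def)
next
  case (child f X)
  then show ?case
    using value_range_child[OF e] by (simp add: position_child evaluate_add evaluate_times_e[OF e(3)])
qed

lemma face_tail:
  assumes "f \<in> faces"
  shows "(\<lambda>k. f (Suc k)) \<in> faces \<and> f 0 \<in> sub_faces (f 1) \<and> f = child (\<lambda>k. f (Suc k)) (f 0)"
  using assms
proof (induction rule: faces_induct)
  case const
  show ?case by (simp add: const_C_in_faces child_const_C)
next
  case (child f X)
  show ?case using child.hyps by simp
qed

text \<open>Ancestors are peeled off one at a time: the value of the common position fixes the type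
  of the parent, hence the displacement, and injectivity of \<open>times_e\<close> gives equal
  parent positions. The induction is on a generation from which both sequences are constantly
  \<open>C\<close>.\<close>

lemma face_eqI:
  assumes "f \<in> faces" "g \<in> faces" "f 0 = g 0" "position f = position g"
  shows "f = g"
proof -
  obtain e :: real where e: "0 < e" "e < 1" "e ^ 3 + e ^ 2 + e = 1"
    by (rule tribonacci_root)
  have "f = g" if "\<forall>k\<ge>n. f k = C" "\<forall>k\<ge>n. g k = C" "f \<in> faces" "g \<in> faces" "f 0 = g 0"
    "position f = position g" for n f g
    using that
  proof (induction n arbitrary: f g)
    case 0
    then show ?case by (intro ext) simp
  next
    case (Suc n)
    define f' g' where "f' = (\<lambda>k. f (Suc k))" and "g' = (\<lambda>k. g (Suc k))"
    have f': "f' \<in> faces" "f 0 \<in> sub_faces (f' 0)" "f = child f' (f 0)"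
      using face_tail[OF \<open>f \<in> faces\<close>] by (simp_all add: f'_def)
    have g': "g' \<in> faces" "g 0 \<in> sub_faces (g' 0)" "g = child g' (g 0)"
      using face_tail[OF \<open>g \<in> faces\<close>] by (simp_all add: g'_def)
    have eq: "times_e (position f') + displacement (f' 0) (f 0) =
        times_e (position g') + displacement (g' 0) (f 0)"
      using Suc.prems(5,6) position_child[OF f'(1), of "f 0"] position_child[OF g'(1), of "g 0"]
        f'(3) g'(3) by simp
    from arg_cong[OF eq, of "evaluate e"] have "f' 0 = g' 0"
      using value_range_parent[OF e(1) position_range[OF e f'(1)] f'(2) position_range[OF e g'(1)]]
        g'(2) Suc.prems(5)
      by (simp add: evaluate_add evaluate_times_e[OF e(3)])
    moreover from this eq have "position f' = position g'"
      by (simp add: inj_times_e)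
    ultimately have "f' = g'"
      by (intro Suc.IH f'(1) g'(1)) (use Suc.prems(1,2) in \<open>auto simp: f'_def g'_def\<close>)
    then show ?case using f'(3) g'(3) Suc.prems(5) by simp
  qed
  moreover obtain m n where "\<forall>k\<ge>m. f k = C" "\<forall>k\<ge>n. g k = C"
    using faces_eventually_C assms(1,2) by metis
  ultimately show ?thesis
    using assms by (metis max.bounded_iff)
qed

lemma project_eq_imp: "project u = project v \<Longrightarrow> \<exists>k. u = v + (k, k, k)"
proof (cases u; cases v)
  fix x y z x' y' z' assume "project u = project v" "u = (x, y, z)" "v = (x', y', z')"
  then have "x + y - 2 * z = x' + y' - 2 * z'" "2 * y - x - z = 2 * y' - x' - z'" by simp_all
  then have "u = v + (x - x', x - x', x - x')"
    using \<open>u = _\<close> \<open>v = _\<close> by simp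
  then show ?thesis by blast
qed

text \<open>The second cell of \<open>C\<close> carries the interval of the first shifted by its
  offset 1. In the order \<open>C\<close>, \<open>B\<close>, \<open>C\<close>, \<open>A\<close> the
  four intervals fit end to end and fill \<open>{0..<1 + e + e\<^sup>2}\<close>.\<close>

fun cell_range :: "real \<Rightarrow> ptype \<Rightarrow> lattice \<Rightarrow> real set" where
  "cell_range e C v = (if v = 0 then {0..<e} else {1..<1 + e})"
| "cell_range e X v = value_range e X"

lemma cell_range:
  assumes e: "0 < e" "e < 1" "e ^ 3 + e ^ 2 + e = 1" and "f \<in> faces" "v \<in> cell_offsets (f 0)"
  shows "evaluate e (position f + v) \<in> cell_range e (f 0) v"
  using position_range[OF assms(1-4)] assms(5)
  by (cases "f 0") (auto simp: evaluate_add zero_prod_def)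

lemma face_cells_disjoint:
  assumes "f \<in> faces" "g \<in> faces" "c \<in> face_cells f" "c \<in> face_cells g"
  shows "f = g"
proof -
  obtain e :: real where e: "0 < e" "e < 1" "e ^ 3 + e ^ 2 + e = 1"
    by (rule tribonacci_root)
  obtain v w where v: "v \<in> cell_offsets (f 0)" "c = project (position f + v)"
    and w: "w \<in> cell_offsets (g 0)" "c = project (position g + w)"
    using assms(3,4) unfolding face_cells_def by blast
  obtain k where k: "position f + v = position g + w + (k, k, k)"
    using project_eq_imp v(2) w(2) by metis
  define \<kappa> where "\<kappa> = 1 + e + e\<^sup>2"
  have range: "cell_range e X u \<subseteq> {0..<\<kappa>}" for X u
    using e by (cases X) (auto simp: \<kappa>_def add_nonneg_nonneg)
  have rf: "evaluate e (position f + v) \<in> cell_range e (f 0) v" by (rule cell_range[OF e assms(1) v(1)])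
  have rg: "evaluate e (position g + w) \<in> cell_range e (g 0) w" by (rule cell_range[OF e assms(2) w(1)])
  have val: "evaluate e (position f + v) = evaluate e (position g + w) + real_of_int k * \<kappa>"
    unfolding k by (simp add: evaluate_add \<kappa>_def algebra_simps)
  have "0 < \<kappa>" using e by (simp add: \<kappa>_def add_pos_nonneg)
  \<comment> \<open>Two values in a half-open interval of length \<open>\<kappa>\<close> differ by
    less than \<open>\<kappa>\<close>, so the ambiguity \<open>(k, k, k)\<close> left by
    \<open>project\<close> disappears.\<close>
  have "real_of_int k * \<kappa> < 1 * \<kappa> \<and> (-1) * \<kappa> < real_of_int k * \<kappa>"
    using val subsetD[OF range rf] subsetD[OF range rg] unfolding atLeastLessThan_iff by linarith
  then have "real_of_int k < 1 \<and> -1 < real_of_int k"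
    using mult_less_cancel_right_pos[OF \<open>0 < \<kappa>\<close>] by blast
  then have "k = 0" by linarith
  then have same: "position f + v = position g + w" using k by (simp add: zero_prod_def[symmetric])
  have "0 < e\<^sup>2" using e by simp
  then have "f 0 = g 0 \<and> v = w"
    using rf rg v(1) w(1) e unfolding same
    by (cases "f 0"; cases "g 0") (auto split: if_splits)
  then show ?thesis using face_eqI[OF assms(1,2)] same by simp
qed


section \<open>Corners of faces and cells\<close>

text \<open>The corners of a regular hexagon, counterclockwise, in a basis of unit vectors at 120
  degrees. The distorted picture keeps all corners integral and all later geometry linear with
  rational coefficients.\<close>

definition hex :: "nat \<Rightarrow> int \<times> int" where
  "hex k = [(1, 0), (1, 1), (0, 1), (-1, 0), (-1, -1), (0, -1)] ! (k mod 6)"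

text \<open>For \<open>C\<close> this is the outline of the hexagons centred at
  \<open>(0, 0)\<close> and \<open>(1, -1)\<close>: sides 0 to 4 belong to the second, sides 5 to 9
  to the first, and the suppressed common edge joins corners 0 and 5.\<close>

fun corners :: "ptype \<Rightarrow> (int \<times> int) list" where
  "corners C = [(0, -1), (0, -2), (1, -2), (2, -1), (2, 0), (1, 0), (1, 1), (0, 1), (-1, 0), (-1, -1)]"
| "corners _ = [(1, 0), (1, 1), (0, 1), (-1, 0), (-1, -1), (0, -1)]"

definition corner :: "face \<Rightarrow> nat \<Rightarrow> int \<times> int" where
  "corner f i = project (position f) + corners (f 0) ! (i mod nsides (f 0))"

lemma hex_simps [simp]:
  "hex 0 = (1, 0)" "hex (Suc 0) = (1, 1)" "hex 1 = (1, 1)" "hex 2 = (0, 1)" "hex (Suc (Suc 0)) = (0, 1)" "hex 3 = (-1, 0)"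
  "hex 4 = (-1, -1)" "hex 5 = (0, -1)" "hex 6 = (1, 0)"
  by (simp_all add: hex_def)

text \<open>This finite check is where the honeycomb is seen to respect the gluings: in every entry
  of the table the two sides occupy the same segment with opposite orientations.\<close>

lemma adjacency_corners:
  assumes "(X, i, Y, j, v) \<in> adjacency"
  shows "corners X ! (i mod nsides X) = project v + corners Y ! (Suc j mod nsides Y) \<and>
    corners X ! (Suc i mod nsides X) = project v + corners Y ! (j mod nsides Y)"
  using assms unfolding adjacency_def insert_iff empty_iff
  by (elim disjE; simp)

lemma glued_along_corners:
  assumes "glued_along f i g j"
  shows "corner f i = corner g (Suc j) \<and> corner f (Suc i) = corner g j"
proof -
  have *: "corner f i = corner g (Suc j) \<and> corner f (Suc i) = corner g j"
    if "((f, i), (g, j)) \<in> glued_sides" for f i g j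
    using adjacency_corners[OF glued_sides_adjacency[OF that, THEN conjunct2, THEN conjunct2]]
    by (simp add: corner_def project_diff)
  show ?thesis
    using assms *[of f i g j] *[of g j f i] unfolding glued_along_def by metis
qed

lemma glued_along_sides:
  assumes "glued_along f i g j"
  shows "f \<in> faces" "g \<in> faces" "i < nsides (f 0)" "j < nsides (g 0)"
  using assms glued_sides_adjacency adjacency_sides unfolding glued_along_def by blast+

lemma project_0 [simp]: "project 0 = 0"
  by (simp add: zero_prod_def)

lemma face_cells_simp:
  "face_cells f = (if f 0 = C then {project (position f), project (position f) + (1, -1)}
    else {project (position f)})"
  by (cases "f 0") (simp_all add: face_cells_def project_add)

lemma side_of_cell:
  assumes "i < nsides (f 0)"
  shows "\<exists>c\<in>face_cells f. \<exists>k<6. corner f i = c + hex k \<and> corner f (Suc i) = c + hex (Suc k)"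
proof -
  obtain a b where p: "project (position f) = (a, b)" by fastforce
  show ?thesis
    using assms
    by (cases "f 0"; simp add: less_6 less_10; elim disjE;
        simp add: face_cells_simp corner_def p less_6 conj_disj_distribR ex_disj_distrib)
qed

lemma cell_side:
  assumes "c \<in> face_cells f" "k < 6"
  shows "(\<exists>i<nsides (f 0). corner f i = c + hex k \<and> corner f (Suc i) = c + hex (Suc k)) \<or>
    c + hex k + hex (Suc k) \<in> face_cells f"
proof (cases "f 0 = C")
  case False
  then have "corner f i = c + hex i" "nsides (f 0) = 6" for i
    using assms(1) by (cases "f 0"; simp add: corner_def hex_def face_cells_simp)+
  then show ?thesis using assms(2) by auto
next
  case True
  obtain a b where p: "project (position f) = (a, b)" by fastforce
  have k: "k = 0 \<or> k = 1 \<or> k = 2 \<or> k = 3 \<or> k = 4 \<or> k = 5"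
    using assms(2) by (simp add: less_6)
  consider "c = (a, b)" | "c = (a + 1, b - 1)"
    using assms(1) True by (auto simp: face_cells_simp p)
  then show ?thesis
  proof cases
    case 1
    show ?thesis
    proof (cases "k = 5")
      case True
      then show ?thesis using 1 \<open>f 0 = C\<close> by (simp add: face_cells_simp p)
    next
      case False
      \<comment> \<open>Edge 5 of the cell at the position itself is the suppressed one; edges 0 to
        4 are the sides 5 to 9 of the decagon.\<close>
      then have "5 + k < 10 \<and> corner f (5 + k) = c + hex k \<and> corner f (Suc (5 + k)) = c + hex (Suc k)"
        using k 1 \<open>f 0 = C\<close> by (elim disjE; simp add: corner_def p)
      then show ?thesis using \<open>f 0 = C\<close> by (metis nsides.simps(3))
    qed
  next
    case 2
    show ?thesis
    proof (cases "k = 2")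
      case True
      then show ?thesis using 2 \<open>f 0 = C\<close> by (simp add: face_cells_simp p)
    next
      case False
      \<comment> \<open>In the other cell edge 2 is suppressed, and edges 3, 4, 5, 0, 1 are the
        sides 0 to 4.\<close>
      let ?i = "(k + 3) mod 6"
      have "?i < 10 \<and> corner f ?i = c + hex k \<and> corner f (Suc ?i) = c + hex (Suc k)"
        using k 2 \<open>f 0 = C\<close> False by (elim disjE; simp add: corner_def p)
      then show ?thesis using \<open>f 0 = C\<close> by (metis nsides.simps(3))
    qed
  qed
qed

text \<open>The sum \<open>c + hex k + hex (Suc k)\<close> is the reflection of the centre
  \<open>c\<close> in the midpoint of the edge. Partners traverse the edge in opposite directions,
  so their cells lie on different sides of it.\<close>

lemma cell_across_side:
  assumes "corner f i = c + hex k" "corner f (Suc i) = c + hex (Suc k)" "k < 6"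
    and "glued_along f i g j"
  shows "c + hex k + hex (Suc k) \<in> face_cells g"
proof -
  obtain d l where d: "d \<in> face_cells g" "l < 6"
      "corner g j = d + hex l" "corner g (Suc j) = d + hex (Suc l)"
    using side_of_cell[of j g] glued_along_sides(4)[OF assms(4)] by blast
  obtain a b where c: "c = (a, b)" by fastforce
  obtain a' b' where d': "d = (a', b')" by fastforce
  have eq: "d + hex l = c + hex (Suc k)" "d + hex (Suc l) = c + hex k"
    using glued_along_corners[OF assms(4)] assms(1,2) d by simp_all
  have "d = c + hex k + hex (Suc k)"
    using eq assms(3) d(2) unfolding less_6 c d'
    by (elim disjE; simp)
  then show ?thesis using d(1) by simp
qed

lemma neighbour_cell_covered:
  assumes "f \<in> faces" "c \<in> face_cells f" "k < 6"
  shows "\<exists>g\<in>faces. c + hex k + hex (Suc k) \<in> face_cells g"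
  using cell_side[OF assms(2,3)] every_side_glued[OF assms(1)] cell_across_side[OF _ _ assms(3)]
    glued_along_sides(2) assms(1) by metis

text \<open>The vectors \<open>(2, 1)\<close> and \<open>(-1, 1)\<close> generate the lattice of
  centres, and a step by either of them or its negative leads to a neighbouring cell. The walk
  starts at the cell \<open>(0, 0)\<close> of the root face.\<close>

lemma all_cells_covered:
  assumes "3 dvd m + n"
  shows "\<exists>f\<in>faces. (m, n) \<in> face_cells f"
proof -
  let ?K = "\<Union>(face_cells ` faces)"
  have step: "(a + 2, b + 1) \<in> ?K" "(a - 2, b - 1) \<in> ?K" "(a - 1, b + 1) \<in> ?K" "(a + 1, b - 1) \<in> ?K"
    if "(a, b) \<in> ?K" for a b
    using that neighbour_cell_covered[of _ "(a, b)" 0] neighbour_cell_covered[of _ "(a, b)" 3]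
      neighbour_cell_covered[of _ "(a, b)" 2] neighbour_cell_covered[of _ "(a, b)" 5]
    by (auto simp: add.commute)
  have 0: "(0, 0) \<in> ?K"
    using const_C_in_faces by (force simp: face_cells_simp zero_prod_def)
  have 1: "(2 * s, s) \<in> ?K" for s
  proof (induction s rule: int_induct[where k = 0])
    case base
    show ?case using 0 by simp
  next
    case (step1 i)
    then show ?case using step(1)[of "2 * i" i] by (simp add: algebra_simps)
  next
    case (step2 i)
    then show ?case using step(2)[of "2 * i" i] by (simp add: algebra_simps)
  qed
  have 2: "(2 * s - t, s + t) \<in> ?K" for s t
  proof (induction t rule: int_induct[where k = 0])
    case base
    show ?case using 1 by simp
  next
    case (step1 i)
    then show ?case using step(3)[of "2 * s - i" "s + i"] by (simp add: algebra_simps)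
  next
    case (step2 i)
    then show ?case using step(4)[of "2 * s - i" "s + i"] by (simp add: algebra_simps)
  qed
  obtain s where "m + n = 3 * s" using assms by blast
  then have "(m, n) = (2 * s - (n - s), s + (n - s))" by simp
  then show ?thesis using 2[of s "n - s"] by auto
qed

lemma face_cells_lattice: "(m, n) \<in> face_cells f \<Longrightarrow> 3 dvd m + n"
proof -
  have "3 dvd fst (project u) + snd (project u)" for u
  proof (cases u)
    case (fields x y z)
    then have "fst (project u) + snd (project u) = 3 * (y - z)" by simp
    then show ?thesis by simp
  qed
  moreover assume "(m, n) \<in> face_cells f"
  then obtain v where "(m, n) = project (position f + v)" by (auto simp: face_cells_def)
  ultimately show "3 dvd m + n" by (metis fst_conv snd_conv)
qed


section \<open>Star-shaped charts of the tiles\<close>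

definition pt :: "real \<Rightarrow> real \<Rightarrow> real ^ 2" where
  "pt x y = vector [x, y]"

lemma pt_simps [simp]: "pt x y $ 1 = x" "pt x y $ 2 = y"
  by (simp_all add: pt_def)

lemma plane_eq_iff: "p = q \<longleftrightarrow> p $ 1 = q $ 1 \<and> p $ 2 = q $ 2" for p q :: "real ^ 2"
  by (simp add: vec_eq_iff forall_2)

definition emb :: "int \<times> int \<Rightarrow> real ^ 2" where
  "emb c = pt (of_int (fst c)) (of_int (snd c))"

lemma emb_simps [simp]: "emb c $ 1 = of_int (fst c)" "emb c $ 2 = of_int (snd c)"
  by (simp_all add: emb_def)

lemma emb_add: "emb (c + d) = emb c + emb d"
  by (simp add: plane_eq_iff)

text \<open>For \<open>C\<close> this is the midpoint of the suppressed edge. The decagon is not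
  convex, but it is star-shaped about this point and symmetric under the half turn around
  it.\<close>

fun star_centre :: "ptype \<Rightarrow> real ^ 2" where
  "star_centre C = pt (1/2) (-1/2)"
| "star_centre _ = 0"

definition ray :: "ptype \<Rightarrow> nat \<Rightarrow> real ^ 2" where
  "ray X i = emb (corners X ! (i mod nsides X)) - star_centre X"

lemma nsides_pos [simp]: "0 < nsides X" and nsides_gt_1 [simp]: "Suc 0 < nsides X"
  by (cases X; simp)+

lemma ray_mod [simp]: "ray X (i mod nsides X) = ray X i"
  by (simp add: ray_def)

lemma ray_add_mod: "ray X (i mod nsides X + k) = ray X (i + k)"
  by (simp add: ray_def mod_add_left_eq)

definition cross :: "real ^ 2 \<Rightarrow> real ^ 2 \<Rightarrow> real" where
  "cross u v = u $ 1 * v $ 2 - u $ 2 * v $ 1"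

lemma cross_linear: "cross u (a *\<^sub>R v + b *\<^sub>R w) = a * cross u v + b * cross u w"
  and cross_self [simp]: "cross u u = 0" and cross_minus_right: "cross u (- v) = - cross u v"
  and cross_swap: "cross u v = - cross v u"
  by (simp_all add: cross_def algebra_simps)

text \<open>A finite check once \<open>i\<close> is reduced modulo the number of sides. It records
  the counterclockwise order of the rays without any use of angles.\<close>

lemma ray_turn:
  assumes "0 < k" "2 * k < nsides X"
  shows "0 < cross (ray X i) (ray X (i + k))"
proof -
  have "0 < cross (ray X j) (ray X (j + k))" if "j < nsides X" for j
  proof (cases "X = C")
    case True
    then have "k = 1 \<or> k = 2 \<or> k = 3 \<or> k = 4" using assms by auto
    then show ?thesis using that unfolding True
      by (simp add: less_10; elim disjE; simp add: ray_def cross_def)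
  next
    case False
    then have "k = 1 \<or> k = 2" using assms by (cases X) auto
    then show ?thesis using that False
      by (cases X; simp add: less_6; elim disjE; simp add: ray_def cross_def)
  qed
  from this[of "i mod nsides X"] show ?thesis by (simp add: ray_add_mod)
qed

lemma ray_opposite: "ray X (i + nsides X div 2) = - ray X i"
proof -
  have "ray X (j + nsides X div 2) = - ray X j" if "j < nsides X" for j
    using that by (cases X; simp add: less_6 less_10; elim disjE; simp add: ray_def plane_eq_iff)
  from this[of "i mod nsides X"] show ?thesis by (simp add: ray_add_mod)
qed

lemma ray_neq_0: "ray X i \<noteq> 0"
proof
  assume "ray X i = 0"
  moreover have "0 < cross (ray X i) (ray X (i + 1))" by (rule ray_turn) (cases X; simp)+
  ultimately show False by (simp add: cross_def)
qed

lemma cone_same: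
  assumes "a *\<^sub>R ray X i + b *\<^sub>R ray X (Suc i) = a' *\<^sub>R ray X i + b' *\<^sub>R ray X (Suc i)"
  shows "a = a' \<and> b = b'"
proof -
  have pos: "0 < cross (ray X i) (ray X (Suc i))" using ray_turn[of 1 X i] by (cases X) simp_all
  have "b * cross (ray X i) (ray X (Suc i)) = b' * cross (ray X i) (ray X (Suc i))"
    using arg_cong[OF assms, of "cross (ray X i)"] by (simp add: cross_linear)
  then have "b = b'" using pos by simp
  moreover from this have "a = a'" using assms ray_neq_0[of X i] by simp
  ultimately show ?thesis by simp
qed

text \<open>Taking the cross product with ray \<open>i + 1\<close> separates the cones: the left
  side becomes nonpositive and the right side nonnegative, so all terms vanish. The boundary cases
  are \<open>m = 1\<close>, where the cones share ray \<open>i + 1\<close>, and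
  \<open>2 * m = nsides X\<close>, where the last ray is opposite to it.\<close>

lemma cone_later:
  assumes m: "0 < m" "2 * m \<le> nsides X" and nonneg: "0 \<le> a" "0 \<le> b" "0 \<le> a'" "0 \<le> b'"
    and eq: "a *\<^sub>R ray X i + b *\<^sub>R ray X (Suc i) = a' *\<^sub>R ray X (i + m) + b' *\<^sub>R ray X (Suc (i + m))"
  shows "a = 0 \<and> b' = 0 \<and> (if m = 1 then b = a' else b = 0 \<and> a' = 0)"
proof -
  let ?x = "cross (ray X (Suc i))"
  have pos: "0 < cross (ray X i) (ray X (Suc i))" using ray_turn[of 1 X i] by (cases X) simp_all
  have 1: "- a * cross (ray X i) (ray X (Suc i)) = a' * ?x (ray X (i + m)) + b' * ?x (ray X (Suc (i + m)))"
    using arg_cong[OF eq, of ?x] cross_swap[of "ray X (Suc i)" "ray X i"] by (simp add: cross_linear)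
  have 2: "0 < ?x (ray X (i + m))" if "m \<noteq> 1"
  proof -
    have "0 < m - 1" "Suc i + (m - 1) = i + m" "2 * (m - 1) < nsides X" using m that by simp_all
    then show ?thesis using ray_turn[of "m - 1" X "Suc i"] by simp
  qed
  then have ge: "0 \<le> ?x (ray X (i + m))" by (cases "m = 1") (simp_all add: less_imp_le)
  have 3: "2 * m < nsides X \<Longrightarrow> 0 < ?x (ray X (Suc (i + m)))"
    using ray_turn[of m X "Suc i"] m by simp
  have opp: "2 * m = nsides X \<Longrightarrow> ray X (Suc (i + m)) = - ray X (Suc i)"
    using ray_opposite[of X "Suc i"] by (metis add_Suc nonzero_mult_div_cancel_left zero_neq_numeral)
  have 4: "0 \<le> ?x (ray X (Suc (i + m)))"
    using 3 opp m(2) by (cases "2 * m = nsides X") (simp_all add: cross_minus_right)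
  have "0 \<le> a * cross (ray X i) (ray X (Suc i))" "0 \<le> a' * ?x (ray X (i + m))"
    "0 \<le> b' * ?x (ray X (Suc (i + m)))"
    using nonneg pos ge 4 by simp_all
  then have "a * cross (ray X i) (ray X (Suc i)) = 0" "a' * ?x (ray X (i + m)) = 0"
    "b' * ?x (ray X (Suc (i + m))) = 0"
    using 1 by linarith+
  then have a: "a = 0" and a': "m \<noteq> 1 \<Longrightarrow> a' = 0" and b': "2 * m < nsides X \<Longrightarrow> b' = 0"
    using pos 2 3 by auto
  show ?thesis
  proof (cases "m = 1")
    case True
    then have "b' = 0" using b' by (cases X) auto
    then show ?thesis using a True eq ray_neq_0[of X "Suc i"] by simp
  next
    case False
    have "b = 0 \<and> b' = 0"
    proof (cases "2 * m = nsides X")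
      case True
      then have "(b + b') *\<^sub>R ray X (Suc i) = 0"
        using eq a a'[OF False] opp by (simp add: scaleR_add_left)
      then show ?thesis using nonneg ray_neq_0[of X "Suc i"] by simp
    next
      case 2: False
      then have "b' = 0" using b' m(2) by simp
      then show ?thesis using eq a a'[OF False] ray_neq_0[of X "Suc i"] by simp
    qed
    then show ?thesis using a a'[OF False] False by simp
  qed
qed

section \<open>Parametrized sectors\<close>

text \<open>A point of a sector has a radius and a parameter along the side. This relation describes
  the coincidences between sectors around a common centre; it will be the fibre relation both of the
  disc and of the tile, which is what allows the two to be matched.\<close>

definition same_point :: "nat \<Rightarrow> nat \<Rightarrow> real \<times> real \<Rightarrow> nat \<Rightarrow> real \<times> real \<Rightarrow> bool" where
  "same_point n i x j y \<longleftrightarrow> fst x = fst y \<and>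
     (fst x = 0 \<or> i = j \<and> snd x = snd y \<or> j = Suc i mod n \<and> snd x = 1 \<and> snd y = 0 \<or>
      i = Suc j mod n \<and> snd x = 0 \<and> snd y = 1)"

lemma same_point_sym: "same_point n i x j y \<longleftrightarrow> same_point n j y i x"
  by (auto simp: same_point_def)

definition disc_sector :: "ptype \<Rightarrow> nat \<Rightarrow> real \<times> real \<Rightarrow> complex" where
  "disc_sector X i x = fst x *\<^sub>R side_point X i (snd x)"

definition tile_sector :: "ptype \<Rightarrow> nat \<Rightarrow> real \<times> real \<Rightarrow> real ^ 2" where
  "tile_sector X i x =
     star_centre X + fst x *\<^sub>R ((1 - snd x) *\<^sub>R ray X i + snd x *\<^sub>R ray X (Suc i))"

lemma tile_sector_eq:
  assumes "i < nsides X" "j < nsides X" "x \<in> {0..1} \<times> {0..1}" "y \<in> {0..1} \<times> {0..1}"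
  shows "tile_sector X i x = tile_sector X j y \<longleftrightarrow> same_point (nsides X) i x j y"
proof
  assume "same_point (nsides X) i x j y"
  then show "tile_sector X i x = tile_sector X j y"
    unfolding same_point_def tile_sector_def using ray_mod[of X "Suc i"] ray_mod[of X "Suc j"] by auto
next
  have cone: "tile_sector X i x = star_centre X + ((fst x * (1 - snd x)) *\<^sub>R ray X i + (fst x * snd x) *\<^sub>R ray X (Suc i))"
    for i x by (simp add: tile_sector_def scaleR_add_right)
  have later: "same_point (nsides X) i x j y"
    if "tile_sector X i x = tile_sector X j y" "j = (i + m) mod nsides X" "0 < m" "2 * m \<le> nsides X"
      "x \<in> {0..1} \<times> {0..1}" "y \<in> {0..1} \<times> {0..1}" for i j x y m
  proof -
    let ?a = "fst x * (1 - snd x)" and ?b = "fst x * snd x"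
    let ?a' = "fst y * (1 - snd y)" and ?b' = "fst y * snd y"
    have rays: "ray X j = ray X (i + m)" "ray X (Suc j) = ray X (Suc (i + m))"
      using ray_mod[of X "i + m"] ray_add_mod[of X "i + m" 1] that(2) by simp_all
    have "?a = 0 \<and> ?b' = 0 \<and> (if m = 1 then ?b = ?a' else ?b = 0 \<and> ?a' = 0)"
    proof (rule cone_later[OF that(3,4)])
      show "0 \<le> ?a" "0 \<le> ?b" "0 \<le> ?a'" "0 \<le> ?b'" using that(5,6) by auto
      show "?a *\<^sub>R ray X i + ?b *\<^sub>R ray X (Suc i) = ?a' *\<^sub>R ray X (i + m) + ?b' *\<^sub>R ray X (Suc (i + m))"
        using that(1) by (simp add: cone rays)
    qed
    moreover have "fst x = ?a + ?b" "fst y = ?a' + ?b'" by (simp_all add: algebra_simps)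
    ultimately show ?thesis
      using that(2) by (cases "m = 1") (auto simp: same_point_def)
  qed
  assume eq: "tile_sector X i x = tile_sector X j y"
  show "same_point (nsides X) i x j y"
  proof (cases "i = j")
    case True
    then have *: "fst x * (1 - snd x) = fst y * (1 - snd y) \<and> fst x * snd x = fst y * snd y"
      using eq by (intro cone_same) (simp add: cone)
    then have "fst x = fst y" by (simp add: algebra_simps)
    then show ?thesis using * True by (auto simp: same_point_def)
  next
    case False
    define m where "m = (j + nsides X - i) mod nsides X"
    have "j = (i + m) mod nsides X"
      using assms(1,2) by (simp add: m_def mod_add_right_eq)
    have m: "0 < m" "m < nsides X"
      using \<open>j = _\<close> assms(1) False by (auto simp: m_def intro!: gr0I)
    have "i = (j + (nsides X - m)) mod nsides X"
    proof -
      have "i = (i + m + (nsides X - m)) mod nsides X" using assms(1) m by simp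
      then show ?thesis unfolding \<open>j = _\<close> by (simp only: mod_add_left_eq)
    qed
    show ?thesis
    \<comment> \<open>\<open>m\<close> is the cyclic distance from \<open>i\<close> to
      \<open>j\<close>. Beyond half a turn the roles are exchanged, and the distance becomes
      \<open>nsides X - m\<close>.\<close>
    proof (cases "2 * m \<le> nsides X")
      case True
      then show ?thesis using later eq \<open>j = _\<close> m assms(3,4) by blast
    next
      case False
      then have "same_point (nsides X) j y i x"
        using later[OF eq[symmetric] \<open>i = _\<close>] m assms(3,4) by simp
      then show ?thesis by (simp add: same_point_sym)
    qed
  qed
qed

lemma side_point_Suc: "side_point X i 1 = side_point X (Suc i mod nsides X) 0" if "i < nsides X"
proof (cases "Suc i = nsides X")
  case True
  then have "side_point X i 1 = cis (2 * pi * (real (nsides X) / real (nsides X)))"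
    unfolding side_point_def by (simp add: add.commute flip: of_nat_Suc)
  then show ?thesis using True by (simp add: side_point_def)
next
  case False
  then show ?thesis using that by (simp add: side_point_def add.commute)
qed

lemma norm_side_point [simp]: "norm (side_point X i s) = 1"
  by (simp add: side_point_def)

lemma side_point_eq:
  assumes "i < nsides X" "j < nsides X" "0 \<le> s" "s \<le> 1" "0 \<le> t" "t \<le> 1"
    and "side_point X i s = side_point X j t"
  shows "i = j \<and> s = t \<or> j = Suc i mod nsides X \<and> s = 1 \<and> t = 0 \<or> i = Suc j mod nsides X \<and> s = 0 \<and> t = 1"
proof -
  let ?n = "real (nsides X)"
  have n: "0 < ?n" by simp
  have "sin (2 * pi * (real i + s) / ?n) = sin (2 * pi * (real j + t) / ?n) \<and>
      cos (2 * pi * (real i + s) / ?n) = cos (2 * pi * (real j + t) / ?n)"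
    using assms(7) by (simp add: side_point_def cis.code complex_eq_iff)
  then obtain k :: int where "2 * pi * (real i + s) / ?n = 2 * pi * (real j + t) / ?n + 2 * pi * k"
    using sin_cos_eq_iff by blast
  then have "2 * pi * (real i + s) = 2 * pi * (real j + t + k * ?n)"
    using n by (simp add: field_simps)
  then have k: "real i + s = real j + t + k * ?n" by simp
  have "real i + 1 \<le> ?n" "real j + 1 \<le> ?n" using assms(1,2) by simp_all
  then have b: "real i + s \<le> ?n" "real j + t \<le> ?n" "0 \<le> real i + s" "0 \<le> real j + t"
    using assms(3-6) by simp_all
  then have "k * ?n \<le> 1 * ?n" "(-1) * ?n \<le> k * ?n" using k by linarith+
  then have "real_of_int k \<le> 1" "-1 \<le> real_of_int k" using n by (simp_all only: mult_le_cancel_right_pos)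
  \<comment> \<open>Both parameters lie between 0 and the number of sides, so they differ by at most
    one full turn; a whole turn occurs only between the end of the last side and the start of side
    0.\<close>
  then consider "k = 0" | "k = 1" | "k = -1" by linarith
  then show ?thesis
  proof cases
    case 1
    then have eq: "real i + s = real j + t" using k by simp
    consider "i = j" | "i < j" | "j < i" by linarith
    then show ?thesis
    proof cases
      case 2
      then have "real i + 1 \<le> real j" by simp
      then have "s = 1" "t = 0" "real j = real (Suc i)" using eq assms(3-6) by simp_all
      then show ?thesis using assms(2) by simp
    next
      case 3
      then have "real j + 1 \<le> real i" by simp
      then have "t = 1" "s = 0" "real i = real (Suc j)" using eq assms(3-6) by simp_all
      then show ?thesis using assms(1) by simp
    qed (use eq in simp)
  next
    case 2
    then have "real i + s = ?n" "real j + t = 0" using k b by simp_all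
    then have "s = 1" "t = 0" "j = 0" "real (Suc i) = ?n"
      using \<open>real i + 1 \<le> ?n\<close> assms(3-6) by simp_all
    then have "s = 1" "t = 0" "j = 0" "Suc i = nsides X" by (simp_all only: of_nat_eq_iff)
    then show ?thesis by simp
  next
    case 3
    then have "real j + t = ?n" "real i + s = 0" using k b by simp_all
    then have "t = 1" "s = 0" "i = 0" "real (Suc j) = ?n"
      using \<open>real j + 1 \<le> ?n\<close> assms(3-6) by simp_all
    then have "t = 1" "s = 0" "i = 0" "Suc j = nsides X" by (simp_all only: of_nat_eq_iff)
    then show ?thesis by simp
  qed
qed

lemma disc_sector_eq:
  assumes "i < nsides X" "j < nsides X" "x \<in> {0..1} \<times> {0..1}" "y \<in> {0..1} \<times> {0..1}"
  shows "disc_sector X i x = disc_sector X j y \<longleftrightarrow> same_point (nsides X) i x j y"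
proof
  assume "same_point (nsides X) i x j y"
  then show "disc_sector X i x = disc_sector X j y"
    unfolding same_point_def disc_sector_def
    using side_point_Suc[OF assms(1)] side_point_Suc[OF assms(2)] by auto
next
  assume eq: "disc_sector X i x = disc_sector X j y"
  have "norm (disc_sector X k z) = fst z" if "z \<in> {0..1} \<times> {0..1}" for k z
    using that by (auto simp: disc_sector_def)
  then have r: "fst x = fst y" using eq assms(3,4) by metis
  show "same_point (nsides X) i x j y"
  proof (cases "fst x = 0")
    case False
    then have "side_point X i (snd x) = side_point X j (snd y)"
      using eq r by (simp add: disc_sector_def)
    moreover have "0 \<le> snd x" "snd x \<le> 1" "0 \<le> snd y" "snd y \<le> 1"
      using assms(3,4) by (simp_all add: mem_Times_iff)
    ultimately show ?thesis
      using side_point_eq[OF assms(1,2)] r unfolding same_point_def by blast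
  qed (use r in \<open>simp add: same_point_def\<close>)
qed

lemma disc_sectors_cover: "(\<Union>i\<in>{..<nsides X}. disc_sector X i ` ({0..1} \<times> {0..1})) = cball 0 1"
proof
  show "(\<Union>i\<in>{..<nsides X}. disc_sector X i ` ({0..1} \<times> {0..1})) \<subseteq> cball 0 1"
    by (auto simp: disc_sector_def)
  show "cball 0 1 \<subseteq> (\<Union>i\<in>{..<nsides X}. disc_sector X i ` ({0..1} \<times> {0..1}))"
  proof
    fix z :: complex assume z: "z \<in> cball 0 1"
    define t where "t = real (nsides X) * (Arg2pi z / (2 * pi))"
    have t: "0 \<le> t" "t < real (nsides X)"
      using Arg2pi_ge_0[of z] Arg2pi_lt_2pi[of z] by (simp_all add: t_def field_simps)
    define i where "i = nat \<lfloor>t\<rfloor>"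
    have i: "real i = of_int \<lfloor>t\<rfloor>" using t by (simp add: i_def)
    have "real i < real (nsides X)" using i t by linarith
    then have "i < nsides X" by simp
    moreover have "z = disc_sector X i (norm z, frac t)"
    proof -
      have "2 * pi * (real i + frac t) / real (nsides X) = Arg2pi z"
        by (simp add: i frac_def t_def)
      then show ?thesis
        using Arg2pi_eq[of z] by (simp add: disc_sector_def side_point_def cis_conv_exp scaleR_conv_of_real mult.commute)
    qed
    moreover have "(norm z, frac t) \<in> {0..1} \<times> {0..1}"
      using z frac_lt_1[of t] by (auto simp: less_imp_le)
    ultimately show "z \<in> (\<Union>i\<in>{..<nsides X}. disc_sector X i ` ({0..1} \<times> {0..1}))" by blast
  qed
qed

definition base_tile :: "ptype \<Rightarrow> (real ^ 2) set" where
  "base_tile X = (\<Union>i\<in>{..<nsides X}. tile_sector X i ` ({0..1} \<times> {0..1}))"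

text \<open>Sectors of the disc are pasted to sectors of the tile; since both families have the
  fibres \<open>same_point\<close>, the result is well defined, continuous and injective. It is
  affine along each side, so charts of neighbouring tiles agree on glued sides.\<close>

lemma base_chart_exists:
  "\<exists>h. continuous_on (cball 0 1) h \<and> inj_on h (cball 0 1) \<and> h ` cball 0 1 = base_tile X \<and>
     (\<forall>i<nsides X. \<forall>x\<in>{0..1} \<times> {0..1}. h (disc_sector X i x) = tile_sector X i x)"
proof -
  obtain h where "continuous_on (\<Union>i\<in>{..<nsides X}. disc_sector X i ` ({0..1} \<times> {0..1})) h"
    and "inj_on h (\<Union>i\<in>{..<nsides X}. disc_sector X i ` ({0..1} \<times> {0..1}))"
    and h: "\<And>i x. i \<in> {..<nsides X} \<Longrightarrow> x \<in> {0..1} \<times> {0..1} \<Longrightarrow> h (disc_sector X i x) = tile_sector X i x"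
  proof (rule homeomorphism_of_compact_families[of "{..<nsides X}" "{0..1} \<times> {0..1}" "disc_sector X" "tile_sector X"])
    show "compact ({0..1::real} \<times> {0..1::real})" by (intro compact_Times compact_Icc)
    show "continuous_on ({0..1} \<times> {0..1}) (disc_sector X i)" for i
      unfolding disc_sector_def side_point_def by (intro continuous_intros) auto
    show "continuous_on ({0..1} \<times> {0..1}) (tile_sector X i)" for i
      unfolding tile_sector_def by (intro continuous_intros)
  qed (simp_all add: disc_sector_eq tile_sector_eq)
  moreover have "h ` cball 0 1 = base_tile X"
    unfolding base_tile_def disc_sectors_cover[of X, symmetric] image_UN image_image
    by (intro SUP_cong refl image_cong) (use h in simp_all)
  ultimately show ?thesis unfolding disc_sectors_cover by auto
qed

definition base_chart :: "ptype \<Rightarrow> complex \<Rightarrow> real ^ 2" where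
  "base_chart X = (SOME h. continuous_on (cball 0 1) h \<and> inj_on h (cball 0 1) \<and>
     h ` cball 0 1 = base_tile X \<and>
     (\<forall>i<nsides X. \<forall>x\<in>{0..1} \<times> {0..1}. h (disc_sector X i x) = tile_sector X i x))"

lemma base_chart:
  shows "continuous_on (cball 0 1) (base_chart X)" and "inj_on (base_chart X) (cball 0 1)"
    and "base_chart X ` cball 0 1 = base_tile X"
    and "i < nsides X \<Longrightarrow> 0 \<le> s \<Longrightarrow> s \<le> 1 \<Longrightarrow>
      base_chart X (side_point X i s) = star_centre X + ((1 - s) *\<^sub>R ray X i + s *\<^sub>R ray X (Suc i))"
proof -
  note * = someI_ex[OF base_chart_exists[of X], folded base_chart_def]
  show "continuous_on (cball 0 1) (base_chart X)" "inj_on (base_chart X) (cball 0 1)"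
    "base_chart X ` cball 0 1 = base_tile X"
    using * by simp_all
  assume "i < nsides X" "0 \<le> s" "s \<le> 1"
  then have "base_chart X (disc_sector X i (1, s)) = tile_sector X i (1, s)"
    using * by simp
  then show "base_chart X (side_point X i s) = star_centre X + ((1 - s) *\<^sub>R ray X i + s *\<^sub>R ray X (Suc i))"
    by (simp add: disc_sector_def tile_sector_def)
qed


section \<open>Tiles as unions of hexagons\<close>

text \<open>The solid hexagon with corners \<open>c + hex k\<close>; each inequality accounts for a
  pair of parallel sides.\<close>

definition hexagon :: "int \<times> int \<Rightarrow> (real ^ 2) set" where
  "hexagon c = {p. \<bar>p $ 1 - of_int (fst c)\<bar> \<le> 1 \<and> \<bar>p $ 2 - of_int (snd c)\<bar> \<le> 1 \<and>
     \<bar>(p $ 1 - of_int (fst c)) - (p $ 2 - of_int (snd c))\<bar> \<le> 1}"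

lemma hexagon_add: "emb d + p \<in> hexagon (d + c) \<longleftrightarrow> p \<in> hexagon c"
  by (simp add: hexagon_def algebra_simps)

lemma tile_sector_I:
  assumes "p = star_centre X + (a *\<^sub>R ray X i + b *\<^sub>R ray X (Suc i))" "i < nsides X"
    and "0 \<le> a" "0 \<le> b" "a + b \<le> 1"
  shows "p \<in> base_tile X"
proof -
  \<comment> \<open>Barycentric coordinates become radius \<open>a + b\<close> and side parameter
    \<open>s\<close>; at the centre \<open>s\<close> is arbitrary and set to 0.\<close>
  define s where "s = (if a + b = 0 then 0 else b / (a + b))"
  have "(a + b) * (1 - s) = a" "(a + b) * s = b"
    using assms(3,4) by (auto simp: s_def field_simps add_nonneg_eq_0_iff)
  then have "p = tile_sector X i (a + b, s)"
    by (simp add: assms(1) tile_sector_def scaleR_add_right)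
  moreover have "(a + b, s) \<in> {0..1} \<times> {0..1}"
    using assms(3-5) by (auto simp: s_def divide_simps)
  ultimately show ?thesis using assms(2) unfolding base_tile_def by blast
qed

lemma base_tile_single:
  assumes "X \<noteq> C"
  shows "base_tile X = hexagon (0, 0)"
proof
  show "base_tile X \<subseteq> hexagon (0, 0)"
  proof
    fix p assume "p \<in> base_tile X"
    then obtain i r s where i: "i < nsides X" and rs: "0 \<le> r" "r \<le> 1" "0 \<le> s" "s \<le> 1"
      and p: "p = tile_sector X i (r, s)"
      unfolding base_tile_def by auto
    define a b where "a = r * (1 - s)" and "b = r * s"
    have "a + b = r" by (simp add: a_def b_def algebra_simps)
    then have ab: "0 \<le> a" "0 \<le> b" "a + b \<le> 1" using rs by (simp_all add: a_def b_def)
    have "p = star_centre X + (a *\<^sub>R ray X i + b *\<^sub>R ray X (Suc i))"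
      by (simp add: p tile_sector_def a_def b_def scaleR_add_right)
    then show "p \<in> hexagon (0, 0)"
      using i ab assms
      by (cases X; simp add: less_6; elim disjE; simp add: hexagon_def ray_def)
  qed
  show "hexagon (0, 0) \<subseteq> base_tile X"
  proof
    fix p assume "p \<in> hexagon (0, 0)"
    then have p: "\<bar>p $ 1\<bar> \<le> 1" "\<bar>p $ 2\<bar> \<le> 1" "\<bar>p $ 1 - p $ 2\<bar> \<le> 1"
      by (simp_all add: hexagon_def)
    have X: "nsides X = 6" "star_centre X = 0" "corners X = corners A" using assms by (cases X; simp)+
    consider "0 \<le> p $ 2" "p $ 2 \<le> p $ 1" | "0 \<le> p $ 1" "p $ 1 \<le> p $ 2" | "p $ 1 \<le> 0" "0 \<le> p $ 2"
      | "p $ 1 \<le> p $ 2" "p $ 2 \<le> 0" | "p $ 2 \<le> p $ 1" "p $ 1 \<le> 0" | "p $ 2 \<le> 0" "0 \<le> p $ 1"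
      by linarith
    then show "p \<in> base_tile X"
    proof cases
      case 1
      then show ?thesis
        by (intro tile_sector_I[of p X "p $ 1 - p $ 2" 0 "p $ 2"]) (use p in \<open>simp_all add: X ray_def plane_eq_iff\<close>)
    next
      case 2
      then show ?thesis
        by (intro tile_sector_I[of p X "p $ 1" 1 "p $ 2 - p $ 1"]) (use p in \<open>simp_all add: X ray_def plane_eq_iff\<close>)
    next
      case 3
      then show ?thesis
        by (intro tile_sector_I[of p X "p $ 2" 2 "- p $ 1"]) (use p in \<open>simp_all add: X ray_def plane_eq_iff\<close>)
    next
      case 4
      then show ?thesis
        by (intro tile_sector_I[of p X "p $ 2 - p $ 1" 3 "- p $ 2"]) (use p in \<open>simp_all add: X ray_def plane_eq_iff\<close>)
    next
      case 5
      then show ?thesis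
        by (intro tile_sector_I[of p X "- p $ 1" 4 "p $ 1 - p $ 2"]) (use p in \<open>simp_all add: X ray_def plane_eq_iff\<close>)
    next
      case 6
      then show ?thesis
        by (intro tile_sector_I[of p X "- p $ 2" 5 "p $ 1"]) (use p in \<open>simp_all add: X ray_def plane_eq_iff\<close>)
    qed
  qed
qed

lemma base_tile_C_symmetric:
  assumes "p \<in> base_tile C"
  shows "2 *\<^sub>R star_centre C - p \<in> base_tile C"
proof -
  obtain i x where i: "i < 10" "x \<in> {0..1} \<times> {0..1}" "p = tile_sector C i x"
    using assms unfolding base_tile_def by auto
  have "ray C ((i + 5) mod 10) = - ray C i" "ray C (Suc ((i + 5) mod 10)) = - ray C (Suc i)"
    using ray_opposite[of C i] ray_opposite[of C "Suc i"] ray_mod[of C "i + 5"] ray_add_mod[of C "i + 5" 1]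
    by simp_all
  then have "2 *\<^sub>R star_centre C - p = tile_sector C ((i + 5) mod 10) x"
    unfolding i(3) tile_sector_def by (simp add: scaleR_2 algebra_simps del: star_centre.simps)
  then show ?thesis
    unfolding base_tile_def using i(2) by (auto intro!: bexI[of _ "(i + 5) mod 10"])
qed

text \<open>The star centre is the midpoint of an edge of each hexagon, so five sectors fill each of
  them. The half turn exchanges the two hexagons, which leaves one to be filled by hand.\<close>

lemma base_tile_C: "base_tile C = hexagon (0, 0) \<union> hexagon (1, -1)"
proof
  show "base_tile C \<subseteq> hexagon (0, 0) \<union> hexagon (1, -1)"
  proof
    fix p assume "p \<in> base_tile C"
    then obtain i r s where i: "i < 10" and rs: "0 \<le> r" "r \<le> 1" "0 \<le> s" "s \<le> 1"
      and p: "p = tile_sector C i (r, s)"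
      unfolding base_tile_def by auto
    define a b where "a = r * (1 - s)" and "b = r * s"
    have "a + b = r" by (simp add: a_def b_def algebra_simps)
    then have ab: "0 \<le> a" "0 \<le> b" "a + b \<le> 1" using rs by (simp_all add: a_def b_def)
    have "p = star_centre C + (a *\<^sub>R ray C i + b *\<^sub>R ray C (Suc i))"
      by (simp add: p tile_sector_def a_def b_def scaleR_add_right)
    then have p: "p $ 1 = 1/2 + a * ray C i $ 1 + b * ray C (Suc i) $ 1"
      "p $ 2 = - 1/2 + a * ray C i $ 2 + b * ray C (Suc i) $ 2" by simp_all
    have "p \<in> hexagon (if i < 5 then (1, -1) else (0, 0))"
      using i ab unfolding hexagon_def mem_Collect_eq p
      by (simp only: less_10; elim disjE; simp add: ray_def; intro conjI; linarith)
    then show "p \<in> hexagon (0, 0) \<union> hexagon (1, -1)" by (simp split: if_splits)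
  qed
  have main: "p \<in> base_tile C" if "p \<in> hexagon (0, 0)" for p
  proof -
    define x y where "x = p $ 1 - 1/2" and "y = p $ 2 + 1/2"
    have px: "p $ 1 = 1/2 + x" "p $ 2 = y - 1/2" by (simp_all add: x_def y_def)
    have p: "\<bar>x + 1/2\<bar> \<le> 1" "\<bar>y - 1/2\<bar> \<le> 1" "\<bar>x - y + 1\<bar> \<le> 1"
      using that unfolding hexagon_def px by (simp_all add: px algebra_simps)
    \<comment> \<open>The separating lines carry the rays 6, 7, 8, 9; \<open>x\<close> and
      \<open>y\<close> are coordinates relative to the star centre.\<close>
    consider "y \<le> 3 * x" | "3 * x \<le> y" "- y \<le> 3 * x" | "3 * x \<le> - y" "- x \<le> 3 * y"
      | "3 * y \<le> - x" "x \<le> 3 * y" | "3 * y \<le> x"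
      by linarith
    then show ?thesis
    proof cases
      case 1
      then show ?thesis
        by (intro tile_sector_I[of p C "3 * x - y" 5 "y - x"])
          (use p in \<open>simp_all add: ray_def plane_eq_iff px field_simps\<close>)
    next
      case 2
      then show ?thesis
        by (intro tile_sector_I[of p C "x + y / 3" 6 "y / 3 - x"])
          (use p in \<open>simp_all add: ray_def plane_eq_iff px field_simps\<close>)
    next
      case 3
      then show ?thesis
        by (intro tile_sector_I[of p C "x / 4 + 3 * y / 4" 7 "- 3 * x / 4 - y / 4"])
          (use p in \<open>simp_all add: ray_def plane_eq_iff px field_simps\<close>)
    next
      case 4
      then show ?thesis
        by (intro tile_sector_I[of p C "y - x / 3" 8 "- y - x / 3"])
          (use p in \<open>simp_all add: ray_def plane_eq_iff px field_simps\<close>)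
    next
      case 5
      then show ?thesis
        by (intro tile_sector_I[of p C "y - x" 9 "x - 3 * y"])
          (use p in \<open>simp_all add: ray_def plane_eq_iff px field_simps\<close>)
    qed
  qed
  moreover have "p \<in> base_tile C" if "p \<in> hexagon (1, -1)" for p
  proof -
    have "2 *\<^sub>R star_centre C - p \<in> hexagon (0, 0)"
      using that by (auto simp: hexagon_def abs_le_iff)
    from base_tile_C_symmetric[OF main[OF this]] show ?thesis by simp
  qed
  ultimately show "hexagon (0, 0) \<union> hexagon (1, -1) \<subseteq> base_tile C" by blast
qed

section \<open>Placed tiles and the incidence of honeycomb cells\<close>

definition chart :: "face \<Rightarrow> complex \<Rightarrow> real ^ 2" where
  "chart f z = emb (project (position f)) + base_chart (f 0) z"

definition tile_of :: "face \<Rightarrow> (real ^ 2) set" where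
  "tile_of f = chart f ` cball 0 1"

lemma continuous_on_chart: "continuous_on (cball 0 1) (chart f)"
  unfolding chart_def by (intro continuous_intros base_chart(1))

lemma inj_on_chart: "inj_on (chart f) (cball 0 1)"
  using base_chart(2)[of "f 0"] by (simp add: chart_def inj_on_def)

lemma tile_of_hexagons: "tile_of f = (\<Union>c\<in>face_cells f. hexagon c)"
proof -
  have t: "(+) (emb d) ` hexagon c = hexagon (d + c)" for c d
  proof -
    have "p \<in> (+) (emb d) ` hexagon c" if "p \<in> hexagon (d + c)" for p
      using that hexagon_add[of d "p - emb d" c] by (intro image_eqI[of _ _ "p - emb d"]) simp_all
    then show ?thesis by (auto simp: hexagon_add)
  qed
  have "tile_of f = (+) (emb (project (position f))) ` base_tile (f 0)"
    unfolding tile_of_def chart_def base_chart(3)[of "f 0", symmetric] by (simp add: image_image)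
  then show ?thesis
    using t[of "project (position f)" "(0, 0)"] t[of "project (position f)" "(1, -1)"]
    by (simp add: face_cells_simp base_tile_C base_tile_single image_Un flip: zero_prod_def)
qed

lemma chart_side_point:
  assumes "i < nsides (f 0)" "0 \<le> s" "s \<le> 1"
  shows "chart f (side_point (f 0) i s) = (1 - s) *\<^sub>R emb (corner f i) + s *\<^sub>R emb (corner f (Suc i))"
  unfolding chart_def base_chart(4)[OF assms] ray_def corner_def emb_add
  by (simp add: algebra_simps)

text \<open>A common point bounds the difference \<open>(m, n)\<close> of the centres and also
  \<open>m - n\<close> by 2 in absolute value; divisibility of \<open>m + n\<close> by 3 leaves only
  the six neighbours. For each of them the inequalities confine the point to the common
  edge.\<close>

lemma hexagon_Int:
  assumes "c \<noteq> d" "3 dvd fst c + snd c" "3 dvd fst d + snd d" "p \<in> hexagon c" "p \<in> hexagon d"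
  shows "\<exists>k<6. d = c + hex k + hex (Suc k) \<and>
    (\<exists>s. 0 \<le> s \<and> s \<le> 1 \<and> p = (1 - s) *\<^sub>R emb (c + hex k) + s *\<^sub>R emb (c + hex (Suc k)))"
proof -
  obtain a b where c: "c = (a, b)" by fastforce
  obtain m n where d: "d = (a + m, b + n)" by (metis add.commute diff_add_cancel surj_pair)
  define x y where "x = p $ 1 - a" and "y = p $ 2 - b"
  have px: "p $ 1 = a + x" "p $ 2 = b + y" by (simp_all add: x_def y_def)
  have xy: "\<bar>x\<bar> \<le> 1" "\<bar>y\<bar> \<le> 1" "\<bar>x - y\<bar> \<le> 1" "\<bar>x - m\<bar> \<le> 1" "\<bar>y - n\<bar> \<le> 1" "\<bar>(x - m) - (y - n)\<bar> \<le> 1"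
    using assms(4,5) by (simp_all add: hexagon_def c d px algebra_simps)
  then have "\<bar>real_of_int m\<bar> \<le> 2" "\<bar>real_of_int n\<bar> \<le> 2" "\<bar>real_of_int (m - n)\<bar> \<le> 2" by simp_all
  then have mn: "\<bar>m\<bar> \<le> 2" "\<bar>n\<bar> \<le> 2" "\<bar>m - n\<bar> \<le> 2" by linarith+
  have "3 dvd m + n"
    using dvd_diff[OF assms(3,2)] by (simp add: c d algebra_simps)
  moreover have "m \<noteq> 0 \<or> n \<noteq> 0" using assms(1) by (simp add: c d)
  ultimately have "(m, n) \<in> {(2, 1), (1, 2), (-1, 1), (-2, -1), (-1, -2), (1, -1)}"
    using mn unfolding insert_iff empty_iff prod.inject by presburger
  then consider "m = 2" "n = 1" | "m = 1" "n = 2" | "m = -1" "n = 1"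
    | "m = -2" "n = -1" | "m = -1" "n = -2" | "m = 1" "n = -1"
    by auto
  then show ?thesis
  proof cases
    case 1
    then show ?thesis using xy by (intro exI[of _ "0::nat"] conjI exI[of _ y]) (simp_all add: c d plane_eq_iff px algebra_simps)
  next
    case 2
    then show ?thesis using xy by (intro exI[of _ "1::nat"] conjI exI[of _ "1 - x"]) (simp_all add: c d plane_eq_iff px algebra_simps)
  next
    case 3
    then have y: "y = 1 + x" using xy by simp
    show ?thesis using 3 xy by (intro exI[of _ "2::nat"] conjI exI[of _ "- x"]) (simp_all add: c d plane_eq_iff px y algebra_simps)
  next
    case 4
    then show ?thesis using xy by (intro exI[of _ "3::nat"] conjI exI[of _ "- y"]) (simp_all add: c d plane_eq_iff px algebra_simps)
  next
    case 5
    then show ?thesis using xy by (intro exI[of _ "4::nat"] conjI exI[of _ "1 + x"]) (simp_all add: c d plane_eq_iff px algebra_simps)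
  next
    case 6
    then have y: "y = x - 1" using xy by simp
    show ?thesis using 6 xy by (intro exI[of _ "5::nat"] conjI exI[of _ x]) (simp_all add: c d plane_eq_iff px y algebra_simps)
  qed
qed

text \<open>In the unit square around the point, the lower left or the upper right corner may be a
  centre, and its hexagon contains the whole square. Otherwise both remaining corners are centres,
  and the diagonal decides between them.\<close>

lemma hexagons_cover: "\<exists>c. 3 dvd fst c + snd c \<and> p \<in> hexagon c"
proof -
  define m n where "m = \<lfloor>p $ 1\<rfloor>" and "n = \<lfloor>p $ 2\<rfloor>"
  define x y where "x = p $ 1 - m" and "y = p $ 2 - n"
  have px: "p $ 1 = m + x" "p $ 2 = n + y" by (simp_all add: x_def y_def)
  have xy: "0 \<le> x" "x \<le> 1" "0 \<le> y" "y \<le> 1"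
    unfolding x_def y_def m_def n_def by linarith+
  have "3 dvd m + n \<or> 3 dvd (m + 1) + n \<or> 3 dvd (m + 1) + (n + 1)" by presburger
  then consider "3 dvd m + n" | "3 dvd (m + 1) + (n + 1)" | "3 dvd (m + 1) + n" "y \<le> x"
    | "3 dvd m + (n + 1)" "x \<le> y"
    by (cases "y \<le> x") (auto simp: algebra_simps)
  then show ?thesis
  proof cases
    case 1
    then show ?thesis using xy by (intro exI[of _ "(m, n)"]) (simp add: hexagon_def px)
  next
    case 2
    then show ?thesis using xy by (intro exI[of _ "(m + 1, n + 1)"]) (simp add: hexagon_def px)
  next
    case 3
    then show ?thesis using xy by (intro exI[of _ "(m + 1, n)"]) (simp add: hexagon_def px)
  next
    case 4
    then show ?thesis using xy by (intro exI[of _ "(m, n + 1)"]) (simp add: hexagon_def px)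
  qed
qed

lemma tiles_cover: "\<exists>f\<in>faces. p \<in> tile_of f"
proof -
  obtain m n where "3 dvd m + n" "p \<in> hexagon (m, n)"
    using hexagons_cover[of p] by auto
  then show ?thesis
    using all_cells_covered[of m n] by (auto simp: tile_of_hexagons)
qed


section \<open>Identifications of boundary points\<close>

lemma chart_glued:
  assumes "glued_along f i g j" "0 \<le> s" "s \<le> 1"
  shows "chart f (side_point (f 0) i s) = chart g (side_point (g 0) j (1 - s))"
  using glued_along_sides[OF assms(1)] glued_along_corners[OF assms(1)] assms(2,3)
  by (simp add: chart_side_point)

text \<open>Two tiles meet in an edge of a honeycomb cell; the partner of the corresponding side owns the
  cell across this edge, hence is the second tile.\<close>

lemma common_point:
  assumes f: "f \<in> faces" and g: "g \<in> faces" and z: "z \<in> cball 0 1" "w \<in> cball 0 1"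
    and eq: "chart f z = chart g w" and ne: "f \<noteq> g"
  obtains i j s where "glued_along f i g j" "0 \<le> s" "s \<le> 1"
    "z = side_point (f 0) i s" "w = side_point (g 0) j (1 - s)"
proof -
  have "chart f z \<in> tile_of f" "chart f z \<in> tile_of g"
    using z imageI[of w "cball 0 1" "chart g"] unfolding tile_of_def eq[symmetric] by simp_all
  then obtain c d where c: "c \<in> face_cells f" "chart f z \<in> hexagon c"
    and d: "d \<in> face_cells g" "chart f z \<in> hexagon d"
    by (auto simp: tile_of_hexagons)
  have "c \<noteq> d" using face_cells_disjoint[OF f g] c(1) d(1) ne by blast
  then obtain k s where k: "k < 6" "d = c + hex k + hex (Suc k)" and s: "0 \<le> s" "s \<le> 1"
    and p: "chart f z = (1 - s) *\<^sub>R emb (c + hex k) + s *\<^sub>R emb (c + hex (Suc k))"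
    using hexagon_Int[OF _ _ _ c(2) d(2)] face_cells_lattice[of "fst c" "snd c" f]
      face_cells_lattice[of "fst d" "snd d" g] c(1) d(1) by auto
  have "d \<notin> face_cells f" using face_cells_disjoint[OF f g] d(1) ne by blast
  then obtain i where i: "i < nsides (f 0)" "corner f i = c + hex k" "corner f (Suc i) = c + hex (Suc k)"
    using cell_side[OF c(1) k(1)] k(2) by blast
  obtain g' j where g': "glued_along f i g' j" using every_side_glued[OF f i(1)] by blast
  have "d \<in> face_cells g'" using cell_across_side[OF i(2,3) k(1) g'] k(2) by simp
  then have "g' = g" using face_cells_disjoint[OF _ g _ d(1)] glued_along_sides(2)[OF g'] by blast
  then have ij: "glued_along f i g j" using g' by simp
  have "chart f z = chart f (side_point (f 0) i s)"
    using p i s by (simp add: chart_side_point)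
  then have 1: "z = side_point (f 0) i s"
    using inj_onD[OF inj_on_chart] z(1) by simp
  have "chart g w = chart g (side_point (g 0) j (1 - s))"
    using eq chart_glued[OF ij s] 1 by simp
  then have "w = side_point (g 0) j (1 - s)"
    using inj_onD[OF inj_on_chart] z(2) by simp
  then show ?thesis using that ij s 1 by blast
qed


section \<open>Sides and boundaries of the tiles\<close>

definition side :: "face \<Rightarrow> nat \<Rightarrow> real \<Rightarrow> real ^ 2" where
  "side f i s = chart f (side_point (f 0) i s)"

lemma side_eq:
  "i < nsides (f 0) \<Longrightarrow> 0 \<le> s \<Longrightarrow> s \<le> 1 \<Longrightarrow>
    side f i s = (1 - s) *\<^sub>R emb (corner f i) + s *\<^sub>R emb (corner f (Suc i))"
  unfolding side_def by (rule chart_side_point)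

lemma side_inj:
  assumes "i < nsides (f 0)" "j < nsides (f 0)" "0 \<le> s" "s \<le> 1" "0 \<le> t" "t \<le> 1"
    and "side f i s = side f j t"
  shows "i = j \<and> s = t \<or> j = Suc i mod nsides (f 0) \<and> s = 1 \<and> t = 0 \<or>
    i = Suc j mod nsides (f 0) \<and> s = 0 \<and> t = 1"
proof -
  have "side_point (f 0) i s = side_point (f 0) j t"
    using inj_onD[OF inj_on_chart assms(7)[unfolded side_def]] by simp
  then show ?thesis using side_point_eq assms(1-6) by blast
qed

lemma corner_mod: "corner f (i mod nsides (f 0)) = corner f i"
  by (simp add: corner_def)

lemma sphere_eq_sides: "sphere 0 1 = (\<Union>i<nsides X. side_point X i ` {0..1})"
proof
  show "(\<Union>i<nsides X. side_point X i ` {0..1}) \<subseteq> sphere 0 1" by auto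
  show "sphere 0 1 \<subseteq> (\<Union>i<nsides X. side_point X i ` {0..1})"
  proof
    fix z :: complex assume z: "z \<in> sphere 0 1"
    then have "z \<in> cball 0 1" by simp
    then obtain i r s where i: "i < nsides X" "0 \<le> r" "0 \<le> s" "s \<le> 1" "z = r *\<^sub>R side_point X i s"
      unfolding disc_sectors_cover[of X, symmetric] by (auto simp: disc_sector_def)
    then have "r = 1" using z by simp
    then show "z \<in> (\<Union>i<nsides X. side_point X i ` {0..1})"
      using i by (intro UN_I[of i] image_eqI[of _ _ s]) simp_all
  qed
qed

lemma tile_topology:
  shows "compact (tile_of f)" and "interior (tile_of f) = chart f ` ball 0 1"
    and "frontier (tile_of f) = chart f ` sphere 0 1" and "closure (interior (tile_of f)) = tile_of f"
  using disc_image[OF continuous_on_chart inj_on_chart, of f] continuous_on_chart[of f]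
  unfolding tile_of_def by (simp_all add: compact_continuous_image)

lemma frontier_tile: "frontier (tile_of f) = (\<Union>i<nsides (f 0). side f i ` {0..1})"
  unfolding tile_topology sphere_eq_sides[of "f 0"] side_def by (simp add: image_UN image_image)

lemma homeomorphism_chart:
  obtains g where "homeomorphism (cball 0 1) (tile_of f) (chart f) g"
  using homeomorphism_compact[OF _ continuous_on_chart refl inj_on_chart] by (auto simp: tile_of_def)

lemma tile_homeomorphic_disc: "tile_of f homeomorphic (cball 0 1 :: (real ^ 2) set)"
proof -
  have "tile_of f homeomorphic (cball 0 1 :: complex set)"
    using homeomorphism_chart[of f] homeomorphic_def homeomorphic_sym by metis
  also have "(cball 0 1 :: complex set) homeomorphic (cball 0 1 :: (real ^ 2) set)"
    by (rule homeomorphic_convex_compact_sets) (simp_all add: aff_dim_cball)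
  finally show ?thesis .
qed

lemma closed_segment_side:
  assumes "i < nsides (f 0)"
  shows "closed_segment (emb (corner f i)) (emb (corner f (Suc i))) = side f i ` {0..1}"
  unfolding closed_segment_image_interval by (intro image_cong refl) (use assms in \<open>simp add: side_eq\<close>)

lemma side_ends:
  assumes "i < nsides (f 0)"
  shows "side f i 0 = emb (corner f i)" "side f i 1 = emb (corner f (Suc i))"
  using assms by (simp_all add: side_eq)

text \<open>Simplicity of the boundary curve comes from injectivity of the chart on the circle:
  sides can meet only where arcs of the circle do.\<close>

lemma polygon_tile: "polygon (tile_of f)"
proof -
  let ?n = "nsides (f 0)"
  define v where "v k = emb (corner f k)" for k
  have n: "3 \<le> ?n" by (cases "f 0") simp_all
  have closed: "v ?n = v 0" using corner_mod[of f ?n] by (simp add: v_def)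
  have seg: "closed_segment (v k) (v (Suc k)) = side f k ` {0..1}" if "k < ?n" for k
    using closed_segment_side[of k f] that by (simp add: v_def)
  have ends: "side f k 0 = v k" "side f k 1 = v (Suc k)" if "k < ?n" for k
    using side_ends[of k f] that by (simp_all add: v_def)
  have upt: "[0..<Suc ?n] = 0 # [1..<?n] @ [?n]"
    using n by (simp add: upt_conv_Cons)
  have list: "map v [0..<Suc ?n] = v 0 # map v [1..<?n] @ [v 0]"
    unfolding upt by (simp add: closed)
  have "simple_path (polyline (map v [0..<Suc ?n]))"
  proof (rule simple_path_polyline[OF n closed])
    fix k assume k: "k < ?n"
    show "v k \<noteq> v (Suc k)"
    proof
      assume "v k = v (Suc k)"
      then have "side f k 0 = side f k 1" using ends[OF k] by simp
      then show False using side_inj[of k f k 0 1] k n by (auto simp: mod_Suc split: if_splits)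
    qed
  next
    fix k l assume kl: "k < l" "l < ?n" "0 < k \<or> Suc l < ?n"
    show "closed_segment (v k) (v (Suc k)) \<inter> closed_segment (v l) (v (Suc l)) \<subseteq> {v (Suc k)}"
    proof
      fix p assume "p \<in> closed_segment (v k) (v (Suc k)) \<inter> closed_segment (v l) (v (Suc l))"
      then obtain s t where st: "0 \<le> s" "s \<le> 1" "0 \<le> t" "t \<le> 1" "p = side f k s" "p = side f l t"
        using seg kl by auto
      \<comment> \<open>Only the last side is followed by side 0, and this pair is excluded by the
        third fact in \<open>kl\<close>.\<close>
      have "k \<noteq> Suc l mod ?n" using kl by (cases "Suc l = ?n") auto
      then have "s = 1"
        using side_inj[of k f l s t] st kl by auto
      then show "p \<in> {v (Suc k)}" using st ends kl by simp
    qed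
  next
    show "closed_segment (v 0) (v 1) \<inter> closed_segment (v (?n - 1)) (v ?n) \<subseteq> {v 0}"
    proof
      fix p assume "p \<in> closed_segment (v 0) (v 1) \<inter> closed_segment (v (?n - 1)) (v ?n)"
      then obtain s t where st: "0 \<le> s" "s \<le> 1" "0 \<le> t" "t \<le> 1" "p = side f 0 s" "p = side f (?n - 1) t"
        using seg[of 0] seg[of "?n - 1"] n by auto
      have "?n - 1 \<noteq> Suc 0 mod ?n" "?n - 1 \<noteq> 0" "?n - 1 < ?n" using n by auto
      then have "s = 0"
        using side_inj[of 0 f "?n - 1" s t] st by auto
      then show "p \<in> {v 0}" using st ends[of 0] by simp
    qed
  qed
  moreover have "path_image (polyline (map v [0..<Suc ?n])) = frontier (tile_of f)"
    using path_image_polyline[of 0 ?n v] n seg by (simp add: frontier_tile atLeast0LessThan del: upt_Suc)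
  moreover have "tile_of f = frontier (tile_of f) \<union> inside (frontier (tile_of f))"
  proof (rule inside_frontier_compact[OF tile_topology(1)])
    have "tile_of f homeomorphic (cball 0 1 :: (real ^ 2) set)" by (rule tile_homeomorphic_disc)
    then show "connected (- tile_of f)"
      by (rule connected_complement_homeomorphic_convex_compact) simp_all
  qed simp
  ultimately show ?thesis
    unfolding polygon_def list by (metis (no_types))
qed


section \<open>The realization map\<close>

definition realize :: "face \<times> complex \<Rightarrow> real ^ 2" where
  "realize x = chart (fst x) (snd x)"

definition discs :: "(face \<times> complex) topology" where
  "discs = sum_topology (\<lambda>_. top_of_set (cball 0 1)) faces"

lemma topspace_discs: "topspace discs = faces \<times> cball 0 1"
  by (simp add: discs_def comp_def)

lemma realize_glued:
  assumes "glued patch_limit x y"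
  shows "realize x = realize y"
  using assms
proof cases
  case (1 f i g j s)
  then have "glued_along f i g j" by (simp add: glued_along_def)
  from chart_glued[OF this] 1 show ?thesis by (simp add: realize_def)
qed

lemma glue_class_eq_iff: "glue_class S x = glue_class S y \<longleftrightarrow> equivclp (glued S) x y"
  unfolding glue_class_def
  by (metis (mono_tags, lifting) Collect_cong equivclp_refl equivclp_sym equivclp_trans mem_Collect_eq)

lemma realize_eq_iff:
  assumes "x \<in> topspace discs" "y \<in> topspace discs"
  shows "realize x = realize y \<longleftrightarrow> glue_class patch_limit x = glue_class patch_limit y"
proof
  assume "glue_class patch_limit x = glue_class patch_limit y"
  then have "equivclp (glued patch_limit) x y" by (simp add: glue_class_eq_iff)
  then show "realize x = realize y"
    by (induction rule: equivclp_induct) (auto dest: realize_glued)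
next
  assume eq: "realize x = realize y"
  obtain f z g w where x: "x = (f, z)" and y: "y = (g, w)" by fastforce
  have fg: "f \<in> faces" "g \<in> faces" "z \<in> cball 0 1" "w \<in> cball 0 1"
    using assms by (auto simp: x y topspace_discs)
  have eq': "chart f z = chart g w" using eq by (simp add: x y realize_def)
  have "equivclp (glued patch_limit) x y"
  proof (cases "f = g")
    case True
    then have "z = w" using inj_onD[OF inj_on_chart] eq' fg(3,4) by blast
    then show ?thesis using True by (simp add: x y)
  next
    case False
    then obtain i j s where "glued_along f i g j" and s: "0 \<le> s" "s \<le> 1"
      "z = side_point (f 0) i s" "w = side_point (g 0) j (1 - s)"
      using common_point[OF fg eq'] by metis
    then consider "((f, i), (g, j)) \<in> glued_sides" | "((g, j), (f, i)) \<in> glued_sides"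
      by (auto simp: glued_along_def)
    then show ?thesis
    proof cases
      case 1
      then show ?thesis
        using glued.intros[OF 1 s(1,2)] s(3,4) by (simp add: x y r_into_equivclp)
    next
      case 2
      then have "glued patch_limit y x"
        using glued.intros[OF 2, of "1 - s"] s by (simp add: x y)
      then show ?thesis by (rule equivclp_sym[OF r_into_equivclp])
    qed
  qed
  then show "glue_class patch_limit x = glue_class patch_limit y" by (simp add: glue_class_eq_iff)
qed

definition tiles :: "'l \<Rightarrow> ('l :: finite) labelled set" where
  "tiles l = (\<lambda>f. (tile_of f, l)) ` faces"

lemma Union_tiles: "\<Union>(fst ` tiles l) = UNIV"
  using tiles_cover by (fastforce simp: tiles_def)

lemma topspace_tiling_topology [simp]: "topspace (tiling_topology T) = \<Union>(fst ` T)"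
proof
  show "topspace (tiling_topology T) \<subseteq> \<Union>(fst ` T)"
    using openin_topspace[of "tiling_topology T", unfolded openin_tiling_topology] by (rule conjunct1)
  have "fst t \<inter> \<Union>(fst ` T) = fst t" if "t \<in> T" for t using that by auto
  then have "openin (tiling_topology T) (\<Union>(fst ` T))"
    by (simp add: openin_tiling_topology)
  then show "\<Union>(fst ` T) \<subseteq> topspace (tiling_topology T)" by (rule openin_subset)
qed

text \<open>Openness is tested tile by tile on one side and disc by disc on the other, and each
  chart is a homeomorphism from its disc onto its tile.\<close>

lemma quotient_map_realize: "quotient_map discs (tiling_topology (tiles l)) realize"
  unfolding quotient_map_def
proof (intro conjI allI impI)
  show "realize ` topspace discs = topspace (tiling_topology (tiles l))"
    unfolding topspace_tiling_topology Union_tiles topspace_discs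
    using tiles_cover by (force simp: tile_of_def realize_def)
  fix U assume "U \<subseteq> topspace (tiling_topology (tiles l))"
  have "openin (top_of_set (cball 0 1)) (cball 0 1 \<inter> chart f -` (tile_of f \<inter> U)) \<longleftrightarrow>
      openin (top_of_set (tile_of f)) (tile_of f \<inter> U)" (is "openin _ ?A \<longleftrightarrow> _") for f
  proof
    assume A: "openin (top_of_set (cball 0 1)) ?A"
    obtain g where "homeomorphism (cball 0 1) (tile_of f) (chart f) g" by (rule homeomorphism_chart)
    from homeomorphism_imp_open_map[OF this A] have "openin (top_of_set (tile_of f)) (chart f ` ?A)" .
    moreover have "chart f ` ?A = tile_of f \<inter> U" by (auto simp: tile_of_def)
    ultimately show "openin (top_of_set (tile_of f)) (tile_of f \<inter> U)" by simp
  next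
    assume "openin (top_of_set (tile_of f)) (tile_of f \<inter> U)"
    then show "openin (top_of_set (cball 0 1)) ?A"
      by (rule continuous_openin_preimage[OF continuous_on_chart, rotated]) (auto simp: tile_of_def)
  qed
  moreover have "{z. (f, z) \<in> {x \<in> topspace discs. realize x \<in> U}} = cball 0 1 \<inter> chart f -` (tile_of f \<inter> U)"
    if "f \<in> faces" for f
    using that by (auto simp: topspace_discs realize_def tile_of_def)
  ultimately show "openin discs {x \<in> topspace discs. realize x \<in> U} \<longleftrightarrow> openin (tiling_topology (tiles l)) U"
    unfolding openin_tiling_topology Union_tiles
    by (simp add: discs_def openin_sum_topology tiles_def)
qed


section \<open>Vertices and edges\<close>

text \<open>All corners are taken, also those on two tiles only, namely the ends of the suppressed
  edges of decagons.\<close>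

definition vertices :: "(real ^ 2) set" where
  "vertices = {side f i 0 | f i. f \<in> faces \<and> i < nsides (f 0)}"

definition edge :: "face \<Rightarrow> nat \<Rightarrow> (real ^ 2) set" where
  "edge f i = side f i ` {0<..<1}"

lemma side_end_in_vertices:
  assumes "f \<in> faces" "i < nsides (f 0)"
  shows "side f i 1 \<in> vertices"
proof -
  let ?j = "Suc i mod nsides (f 0)"
  have "side f i 1 = side f ?j 0"
    using assms(2) corner_mod[of f "Suc i"] by (simp add: side_eq)
  then show ?thesis using assms(1) unfolding vertices_def by fastforce
qed

text \<open>Any partner owns the cell across the side, and a cell has only one owner.\<close>

lemma partner_unique:
  assumes "glued_along f i g j" "glued_along f i g' j'"
  shows "g = g'"
proof -
  obtain c k where "c \<in> face_cells f" "k < 6" "corner f i = c + hex k" "corner f (Suc i) = c + hex (Suc k)"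
    using side_of_cell[of i f] glued_along_sides(3)[OF assms(1)] by blast
  then show ?thesis
    using cell_across_side assms glued_along_sides(2) face_cells_disjoint by metis
qed

lemma common_side:
  assumes "f \<in> faces" "g \<in> faces" "f \<noteq> g" "i < nsides (f 0)" "0 < s" "s < 1"
    and w: "w \<in> cball 0 1" "side f i s = chart g w"
  obtains j where "glued_along f i g j" "w = side_point (g 0) j (1 - s)"
proof -
  have z: "side_point (f 0) i s \<in> cball 0 1" by simp
  obtain i' j s' where g: "glued_along f i' g j" "0 \<le> s'" "s' \<le> 1"
    "side_point (f 0) i s = side_point (f 0) i' s'" "w = side_point (g 0) j (1 - s')"
    using common_point[OF assms(1,2) z w(1) w(2)[unfolded side_def] assms(3)] by blast
  then have "i = i' \<and> s = s'"
    using side_point_eq[OF assms(4) glued_along_sides(3)[OF g(1)], of s s'] assms(5,6) by auto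
  then show ?thesis using that g by blast
qed

lemma edge_disjoint_vertices:
  assumes "f \<in> faces" "i < nsides (f 0)"
  shows "edge f i \<inter> vertices = {}"
proof (rule ccontr)
  assume "edge f i \<inter> vertices \<noteq> {}"
  then obtain s g j where s: "0 < s" "s < 1" and g: "g \<in> faces" "j < nsides (g 0)"
    and eq: "side f i s = side g j 0"
    by (auto simp: edge_def vertices_def)
  show False
  proof (cases "f = g")
    case True
    then show False using side_inj[of i f j s 0] eq s g(2) assms(2) by auto
  next
    case False
    then obtain j' where j': "glued_along f i g j'" "side_point (g 0) j 0 = side_point (g 0) j' (1 - s)"
      using common_side[OF assms(1) g(1) False assms(2) s, of "side_point (g 0) j 0"] eq
      by (auto simp: side_def)
    then show False
      using side_point_eq[OF g(2) glued_along_sides(4)[OF j'(1)], of 0 "1 - s"] s by auto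
  qed
qed

lemma edges_equal:
  assumes "f \<in> faces" "i < nsides (f 0)" "g \<in> faces" "j < nsides (g 0)" "edge f i \<inter> edge g j \<noteq> {}"
  shows "edge f i = edge g j"
proof -
  obtain s t where s: "0 < s" "s < 1" and t: "0 < t" "t < 1" and eq: "side f i s = side g j t"
    using assms(5) by (auto simp: edge_def)
  show ?thesis
  proof (cases "f = g")
    case True
    then show ?thesis using side_inj[of i f j s t] eq s t assms(2,4) by auto
  next
    case False
    then obtain j' where j': "glued_along f i g j'" "side_point (g 0) j t = side_point (g 0) j' (1 - s)"
      using common_side[OF assms(1,3) False assms(2) s, of "side_point (g 0) j t"] eq
      by (auto simp: side_def)
    then have "j = j'"
      using side_point_eq[OF assms(4) glued_along_sides(4)[OF j'(1)], of t "1 - s"] s t by auto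
    then have "side f i r = side g j (1 - r)" if "r \<in> {0<..<1}" for r
      using chart_glued[OF j'(1), of r] that by (simp add: side_def)
    then have "edge f i = side g j ` (\<lambda>r. 1 - r) ` {0<..<1}"
      unfolding edge_def image_image by (intro image_cong refl)
    also have "(\<lambda>r. 1 - r) ` {0<..<1} = {0<..<1::real}"
      by (auto intro!: image_eqI[of _ _ "1 - _"])
    finally show ?thesis by (simp add: edge_def)
  qed
qed

text \<open>In the relative interior of a side of one tile, two further tiles would both be glued to
  that same side, against uniqueness of the partner.\<close>

lemma branch_points_subset: "branch_points (tiles l) \<subseteq> vertices"
proof
  fix v assume "v \<in> branch_points (tiles l)"
  then obtain S where S: "S \<subseteq> {t \<in> tiles l. v \<in> fst t}" "card S = 3"
    by (auto simp: branch_points_def)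
  then obtain t1 t2 t3 where t: "S = {t1, t2, t3}" "t1 \<noteq> t2" "t2 \<noteq> t3" "t1 \<noteq> t3"
    unfolding card_3_iff by blast
  have "\<exists>f\<in>faces. t = (tile_of f, l) \<and> v \<in> tile_of f" if "t \<in> S" for t
    using subsetD[OF S(1) that] by (auto simp: tiles_def)
  then obtain f1 f2 f3 where f: "f1 \<in> faces" "f2 \<in> faces" "f3 \<in> faces"
    and v: "v \<in> tile_of f1" "v \<in> tile_of f2" "v \<in> tile_of f3"
    and ne: "f1 \<noteq> f2" "f2 \<noteq> f3" "f1 \<noteq> f3"
    using t by (metis insertCI)
  obtain z1 z2 z3 where z: "z1 \<in> cball 0 1" "z2 \<in> cball 0 1" "z3 \<in> cball 0 1"
    "v = chart f1 z1" "v = chart f2 z2" "v = chart f3 z3"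
    using v unfolding tile_of_def by auto
  obtain i j s where ij: "glued_along f1 i f2 j" "0 \<le> s" "s \<le> 1" "z1 = side_point (f1 0) i s"
    using common_point[OF f(1,2) z(1,2) _ ne(1)] z(4,5) by metis
  have i: "i < nsides (f1 0)" by (rule glued_along_sides(3)[OF ij(1)])
  have vs: "v = side f1 i s" using z(4) ij(4) by (simp add: side_def)
  consider "s = 0" | "s = 1" | "0 < s" "s < 1" using ij(2,3) by linarith
  then show "v \<in> vertices"
  proof cases
    case 1
    then show ?thesis using vs i f(1) by (auto simp: vertices_def)
  next
    case 2
    then show ?thesis using vs side_end_in_vertices[OF f(1) i] by simp
  next
    case 3
    obtain j' where "glued_along f1 i f3 j'"
      using common_side[OF f(1,3) ne(3) i 3 z(3)] vs z(6) by metis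
    then show ?thesis using partner_unique[OF ij(1)] ne(2) by blast
  qed
qed

lemma vertices_subset: "vertices \<subseteq> (\<Union>t\<in>tiles l. frontier (fst t))"
  by (fastforce simp: vertices_def tiles_def frontier_tile)

lemma boundary_minus_vertices:
  "(\<Union>t\<in>tiles l. frontier (fst t)) - vertices = \<Union>{edge f i | f i. f \<in> faces \<and> i < nsides (f 0)}"
proof
  show "(\<Union>t\<in>tiles l. frontier (fst t)) - vertices \<subseteq> \<Union>{edge f i | f i. f \<in> faces \<and> i < nsides (f 0)}"
  proof
    fix p assume "p \<in> (\<Union>t\<in>tiles l. frontier (fst t)) - vertices"
    then obtain f i s where f: "f \<in> faces" "i < nsides (f 0)" "0 \<le> s" "s \<le> 1" "p = side f i s"
      and p: "p \<notin> vertices"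
      by (auto simp: tiles_def frontier_tile)
    have "s \<noteq> 0" "s \<noteq> 1"
      using f p side_end_in_vertices[OF f(1,2)] by (auto simp: vertices_def)
    then have "p \<in> edge f i" using f(3-5) by (auto simp: edge_def)
    then show "p \<in> \<Union>{edge f i | f i. f \<in> faces \<and> i < nsides (f 0)}" using f(1,2) by blast
  qed
  have "edge f i \<subseteq> frontier (tile_of f)" if "i < nsides (f 0)" for f i
    using that by (force simp: edge_def frontier_tile)
  then show "\<Union>{edge f i | f i. f \<in> faces \<and> i < nsides (f 0)} \<subseteq> (\<Union>t\<in>tiles l. frontier (fst t)) - vertices"
    using edge_disjoint_vertices by (fastforce simp: tiles_def)
qed

text \<open>All lines of the triangular lattice, including parts that are edges of no tile.
  Isolating an edge within this larger set is independent of which edges the tiling uses.\<close>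

definition grid :: "(real ^ 2) set" where
  "grid = {p :: real ^ 2. p $ 1 \<in> \<int> \<or> p $ 2 \<in> \<int> \<or> p $ 1 - p $ 2 \<in> \<int>}"

definition open_edge :: "int \<times> int \<Rightarrow> int \<times> int \<Rightarrow> (real ^ 2) set" where
  "open_edge a b = (\<lambda>s. (1 - s) *\<^sub>R emb a + s *\<^sub>R emb b) ` {0<..<1}"

lemma open_edge_swap: "open_edge b a = open_edge a b"
proof -
  have "open_edge a b \<subseteq> open_edge b a" for a b
  proof
    fix p assume "p \<in> open_edge a b"
    then obtain s where "s \<in> {0<..<1}" "p = (1 - s) *\<^sub>R emb a + s *\<^sub>R emb b"
      by (auto simp: open_edge_def)
    then show "p \<in> open_edge b a"
      unfolding open_edge_def by (intro image_eqI[of _ _ "1 - s"]) (simp_all add: add.commute)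
  qed
  then show ?thesis by blast
qed

lemma Ints_strictly_between: "x \<in> \<int> \<Longrightarrow> of_int n < x \<Longrightarrow> x < of_int n + 1 \<Longrightarrow> False" for x :: real
  by (auto elim!: Ints_cases)

text \<open>The open rhombus formed by the two grid triangles along an edge isolates this edge.\<close>

lemma open_edge_isolated:
  assumes "b - a \<in> {(1, 0), (0, 1), (1, 1), (-1, 0), (0, -1), (-1, -1)}"
  shows "open_edge a b \<subseteq> grid \<and> (\<exists>W. open W \<and> grid \<inter> W = open_edge a b)"
proof -
  have main: "open_edge a b \<subseteq> grid \<and> (\<exists>W. open W \<and> grid \<inter> W = open_edge a b)"
    if "b - a \<in> {(1, 0), (0, 1), (1, 1)}" for a b
  proof -
    obtain m n where a: "a = (m, n)" by fastforce
    from that consider "b = (m + 1, n)" | "b = (m, n + 1)" | "b = (m + 1, n + 1)"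
      by (cases b) (auto simp: a algebra_simps)
    then show ?thesis
    proof cases
      case 1
      let ?W = "{p :: real ^ 2. m < p $ 1 \<and> p $ 1 < m + 1 \<and> m - n < p $ 1 - p $ 2 \<and> p $ 1 - p $ 2 < m - n + 1}"
      have E: "open_edge a b = {p :: real ^ 2. p $ 2 = n \<and> m < p $ 1 \<and> p $ 1 < m + 1}"
      proof (intro set_eqI iffI)
        fix p assume "p \<in> {p :: real ^ 2. p $ 2 = n \<and> m < p $ 1 \<and> p $ 1 < m + 1}"
        then show "p \<in> open_edge a b" unfolding open_edge_def
          by (intro image_eqI[of _ _ "p $ 1 - m"]) (auto simp: a 1 plane_eq_iff algebra_simps)
      qed (auto simp: open_edge_def a 1 algebra_simps)
      have "open ?W" by (intro open_Collect_conj open_Collect_less continuous_intros)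
      moreover have "grid \<inter> ?W = open_edge a b"
      proof (intro set_eqI iffI)
        fix p assume p: "p \<in> grid \<inter> ?W"
        then have "p $ 1 \<notin> \<int>" "p $ 1 - p $ 2 \<notin> \<int>"
          using Ints_strictly_between[of "p $ 1" m] Ints_strictly_between[of "p $ 1 - p $ 2" "m - n"] by auto
        then have "p $ 2 \<in> \<int>" using p by (auto simp: grid_def)
        then obtain k where k: "p $ 2 = of_int k" by (auto elim: Ints_cases)
        have "real_of_int k < of_int (n + 1)" "real_of_int (n - 1) < of_int k" using p k by auto
        then have "k = n" by (simp only: of_int_less_iff)
        then show "p \<in> open_edge a b" using p k by (simp add: E)
      qed (auto simp: E grid_def)
      moreover have "open_edge a b \<subseteq> grid" by (auto simp: E grid_def)
      ultimately show ?thesis by blast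
    next
      case 2
      let ?W = "{p :: real ^ 2. n < p $ 2 \<and> p $ 2 < n + 1 \<and> m - n - 1 < p $ 1 - p $ 2 \<and> p $ 1 - p $ 2 < m - n}"
      have E: "open_edge a b = {p :: real ^ 2. p $ 1 = m \<and> n < p $ 2 \<and> p $ 2 < n + 1}"
      proof (intro set_eqI iffI)
        fix p assume "p \<in> {p :: real ^ 2. p $ 1 = m \<and> n < p $ 2 \<and> p $ 2 < n + 1}"
        then show "p \<in> open_edge a b" unfolding open_edge_def
          by (intro image_eqI[of _ _ "p $ 2 - n"]) (auto simp: a 2 plane_eq_iff algebra_simps)
      qed (auto simp: open_edge_def a 2 algebra_simps)
      have "open ?W" by (intro open_Collect_conj open_Collect_less continuous_intros)
      moreover have "grid \<inter> ?W = open_edge a b"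
      proof (intro set_eqI iffI)
        fix p assume p: "p \<in> grid \<inter> ?W"
        then have "p $ 2 \<notin> \<int>" "p $ 1 - p $ 2 \<notin> \<int>"
          using Ints_strictly_between[of "p $ 2" n] Ints_strictly_between[of "p $ 1 - p $ 2" "m - n - 1"] by auto
        then have "p $ 1 \<in> \<int>" using p by (auto simp: grid_def)
        then obtain k where k: "p $ 1 = of_int k" by (auto elim: Ints_cases)
        have "real_of_int k < of_int (m + 1)" "real_of_int (m - 1) < of_int k" using p k by auto
        then have "k = m" by (simp only: of_int_less_iff)
        then show "p \<in> open_edge a b" using p k by (simp add: E)
      qed (auto simp: E grid_def)
      moreover have "open_edge a b \<subseteq> grid" by (auto simp: E grid_def)
      ultimately show ?thesis by blast
    next
      case 3
      let ?W = "{p :: real ^ 2. m < p $ 1 \<and> p $ 1 < m + 1 \<and> n < p $ 2 \<and> p $ 2 < n + 1}"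
      have E: "open_edge a b = {p :: real ^ 2. p $ 1 - p $ 2 = m - n \<and> m < p $ 1 \<and> p $ 1 < m + 1}"
      proof (intro set_eqI iffI)
        fix p assume "p \<in> {p :: real ^ 2. p $ 1 - p $ 2 = m - n \<and> m < p $ 1 \<and> p $ 1 < m + 1}"
        then show "p \<in> open_edge a b" unfolding open_edge_def
          by (intro image_eqI[of _ _ "p $ 1 - m"]) (auto simp: a 3 plane_eq_iff algebra_simps)
      qed (auto simp: open_edge_def a 3 algebra_simps)
      have "open ?W" by (intro open_Collect_conj open_Collect_less continuous_intros)
      moreover have "grid \<inter> ?W = open_edge a b"
      proof (intro set_eqI iffI)
        fix p assume p: "p \<in> grid \<inter> ?W"
        then have "p $ 1 \<notin> \<int>" "p $ 2 \<notin> \<int>"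
          using Ints_strictly_between[of "p $ 1" m] Ints_strictly_between[of "p $ 2" n] by auto
        then have "p $ 1 - p $ 2 \<in> \<int>" using p by (auto simp: grid_def)
        then obtain k where k: "p $ 1 - p $ 2 = of_int k" by (auto elim: Ints_cases)
        have "real_of_int k < of_int (m - n + 1)" "real_of_int (m - n - 1) < of_int k" using p k by auto
        then have "k = m - n" by (simp only: of_int_less_iff)
        then show "p \<in> open_edge a b" using p k by (simp add: E)
      qed (auto simp: E grid_def)
      moreover have "open_edge a b \<subseteq> grid" by (auto simp: E grid_def)
      ultimately show ?thesis by blast
    qed
  qed
  show ?thesis
  proof (cases "b - a \<in> {(1, 0), (0, 1), (1, 1)}")
    case True
    then show ?thesis by (rule main)
  next
    case False
    then have "a - b \<in> {(1, 0), (0, 1), (1, 1)}"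
      using assms by (cases a; cases b) auto
    from main[OF this] show ?thesis by (simp add: open_edge_swap[of a b])
  qed
qed

lemma edge_isolated:
  assumes "i < nsides (f 0)"
  shows "edge f i \<subseteq> grid \<and> (\<exists>W. open W \<and> grid \<inter> W = edge f i)"
proof -
  have e: "edge f i = open_edge (corner f i) (corner f (Suc i))"
    unfolding edge_def open_edge_def by (intro image_cong refl) (use assms in \<open>simp add: side_eq\<close>)
  obtain c k where "k < 6" "corner f i = c + hex k" "corner f (Suc i) = c + hex (Suc k)"
    using side_of_cell[of i f] assms by blast
  then have "corner f (Suc i) - corner f i \<in> {(1, 0), (0, 1), (1, 1), (-1, 0), (0, -1), (-1, -1)}"
    unfolding less_6 by (elim disjE) simp_all
  then show ?thesis unfolding e by (rule open_edge_isolated)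
qed

text \<open>Edges are connected and pairwise equal or disjoint; a window that isolates an edge in
  \<open>grid\<close> does so among the edges of the tiling, so each edge is open in their
  union.\<close>

lemma components_boundary:
  "components ((\<Union>t\<in>tiles l. frontier (fst t)) - vertices) = {edge f i | f i. f \<in> faces \<and> i < nsides (f 0)}"
proof -
  let ?E = "{edge f i | f i. f \<in> faces \<and> i < nsides (f 0)}"
  have "components (\<Union>?E) = ?E"
  proof (rule connected_open_partition_components[OF refl])
    fix E assume "E \<in> ?E"
    then obtain f i where f: "f \<in> faces" "i < nsides (f 0)" "E = edge f i" by blast
    have "continuous_on {0<..<1} (side f i)"
      by (rule continuous_on_eq[of _ "\<lambda>s. (1 - s) *\<^sub>R emb (corner f i) + s *\<^sub>R emb (corner f (Suc i))"])
        (use f(2) in \<open>auto intro!: continuous_intros simp: side_eq\<close>)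
    then have "connected E"
      unfolding f(3) edge_def by (rule connected_continuous_image) simp
    moreover have "E \<noteq> {}" by (simp add: f(3) edge_def)
    moreover have "openin (top_of_set (\<Union>?E)) E"
    proof -
      obtain W where W: "open W" "grid \<inter> W = E" using edge_isolated[of i f] f(2,3) by blast
      have "\<Union>?E \<subseteq> grid" using edge_isolated by blast
      moreover have "E \<subseteq> \<Union>?E" using f by blast
      ultimately have eq: "E = \<Union>?E \<inter> W" using W(2) by blast
      show ?thesis by (subst eq) (rule openin_open_Int[OF W(1)])
    qed
    ultimately show "connected E \<and> E \<noteq> {} \<and> openin (top_of_set (\<Union>?E)) E" by blast
  next
    fix E E' assume "E \<in> ?E" "E' \<in> ?E" "E \<inter> E' \<noteq> {}"
    then show "E = E'" using edges_equal by blast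
  qed
  then show ?thesis by (simp add: boundary_minus_vertices)
qed

section \<open>Conditions on the tiling and the isomorphism of complexes\<close>

lemma tiling_modeled_on_tiles: "tiling_modeled_on prototiles (tiles l)"
proof -
  have tile: "tile t" if "t \<in> tiles l" for t
    using that tile_topology by (auto simp: tiles_def tile_def)
  have "t \<in> \<Union>prototiles" if "t \<in> tiles l" for t
  proof -
    have "fst t = (+) 0 ` fst t" by simp
    then have "(t, t) \<in> translation_equiv" using tile[OF that] unfolding translation_equiv_def by blast
    moreover have "translation_equiv `` {t} \<in> prototiles"
      unfolding prototiles_def by (rule quotientI) (use tile[OF that] in simp)
    ultimately show ?thesis by blast
  qed
  moreover have "interior (fst t) \<inter> interior (fst u) = {}" if t: "t \<in> tiles l" "u \<in> tiles l" "t \<noteq> u" for t u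
  proof (rule ccontr)
    assume "interior (fst t) \<inter> interior (fst u) \<noteq> {}"
    then obtain p where p: "p \<in> interior (fst t)" "p \<in> interior (fst u)" by blast
    obtain f g where f: "f \<in> faces" "t = (tile_of f, l)" and g: "g \<in> faces" "u = (tile_of g, l)"
      using t(1,2) by (auto simp: tiles_def)
    then obtain z w where z: "z \<in> ball 0 1" "w \<in> ball 0 1" "chart f z = chart g w"
      using p by (auto simp: tile_topology)
    have "f \<noteq> g" using f g t(3) by blast
    then obtain i s where "z = side_point (f 0) i s"
      using common_point[OF f(1) g(1) _ _ z(3)] z(1,2) ball_subset_cball by (metis subsetD)
    then show False using z(1) by simp
  qed
  ultimately show ?thesis
    by (auto simp: tiling_modeled_on_def Union_tiles pairwise_def)
qed

text \<open>Each cell of the tiling is the \<open>realize\<close> image of a set of points in the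
  discs, and \<open>h\<close> turns it into the image of the same set under the gluing
  quotient.\<close>

lemma cw_isomorphic_tiles: "cw_isomorphic (tiling_complex vertices (tiles l)) sigma_infinity"
proof -
  let ?q = "glue_class patch_limit"
  have q: "quotient_map discs (quotient_topology discs ?q) ?q"
    by (rule quotient_map_quotient_topology)
  obtain h where h: "homeomorphic_map (tiling_topology (tiles l)) (quotient_topology discs ?q) h"
    and hq: "\<And>x. x \<in> topspace discs \<Longrightarrow> h (realize x) = ?q x"
    using quotient_maps_same_fibres[OF quotient_map_realize[of l] q realize_eq_iff] by blast
  have image: "h ` realize ` A = ?q ` A" if "A \<subseteq> topspace discs" for A
    unfolding image_image by (intro image_cong refl hq) (use that in blast)
  have "(`) h ` cells (tiling_complex vertices (tiles l)) n = cells sigma_infinity n" for n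
  proof -
    consider "n = 0" | "n = 1" | "n = 2" | "n > 2" by linarith
    then show ?thesis
    proof cases
      case 1
      have "(`) h ` (\<lambda>v. {v}) ` vertices = {h ` realize ` {(f, side_point (f 0) i 0)} | f i. f \<in> faces \<and> i < nsides (f 0)}"
        by (auto simp: vertices_def side_def realize_def)
      also have "\<dots> = {{?q (f, side_point (f 0) i 0)} | f i. f \<in> faces \<and> i < nsides (f 0)}"
      proof -
        have "h ` realize ` {(f, side_point (f 0) i 0)} = {?q (f, side_point (f 0) i 0)}"
          if "f \<in> faces" for f i
          using image[of "{(f, side_point (f 0) i 0)}"] that by (simp add: topspace_discs)
        then show ?thesis by (intro Collect_cong iff_exI) metis
      qed
      finally show ?thesis
        using 1 by (simp add: tiling_complex_def sigma_infinity_def glued_complex_def)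
    next
      case 2
      have "edge f i = realize ` ({f} \<times> side_point (f 0) i ` {0<..<1})" for f i
      proof -
        have "{f} \<times> side_point (f 0) i ` {0<..<1} = (\<lambda>s. (f, side_point (f 0) i s)) ` {0<..<1}" by auto
        then show ?thesis by (simp add: edge_def side_def realize_def image_image)
      qed
      then have "(`) h ` {edge f i | f i. f \<in> faces \<and> i < nsides (f 0)} =
          {h ` realize ` ({f} \<times> side_point (f 0) i ` {0<..<1}) | f i. f \<in> faces \<and> i < nsides (f 0)}"
        by auto
      also have "\<dots> = {?q ` ({f} \<times> side_point (f 0) i ` {0<..<1}) | f i. f \<in> faces \<and> i < nsides (f 0)}"
      proof -
        have "h ` realize ` ({f} \<times> side_point (f 0) i ` {0<..<1}) = ?q ` ({f} \<times> side_point (f 0) i ` {0<..<1})"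
          if "f \<in> faces" for f i
          by (rule image) (use that in \<open>auto simp: topspace_discs\<close>)
        then show ?thesis by (intro Collect_cong iff_exI) metis
      qed
      finally show ?thesis
        using 2 by (simp add: tiling_complex_def sigma_infinity_def glued_complex_def components_boundary)
    next
      case 3
      have "(`) h ` (\<lambda>t. interior (fst t)) ` tiles l = {h ` realize ` ({f} \<times> ball 0 1) | f. f \<in> faces}"
      proof -
        have "realize ` ({f} \<times> ball 0 1) = interior (tile_of f)" for f
        proof -
          have "{f} \<times> ball 0 1 = Pair f ` (ball 0 1 :: complex set)" by auto
          then show ?thesis by (simp add: tile_topology realize_def image_image)
        qed
        then show ?thesis by (simp add: tiles_def image_image Setcompr_eq_image)
      qed
      also have "\<dots> = {?q ` ({f} \<times> ball 0 1) | f. f \<in> faces}"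
      proof -
        have "h ` realize ` ({f} \<times> ball 0 1) = ?q ` ({f} \<times> ball 0 1)" if "f \<in> faces" for f
          by (rule image) (use that in \<open>auto simp: topspace_discs\<close>)
        then show ?thesis by (intro Collect_cong iff_exI) metis
      qed
      finally show ?thesis
        using 3 by (simp add: tiling_complex_def sigma_infinity_def glued_complex_def)
    next
      case 4
      then show ?thesis by (simp add: tiling_complex_def sigma_infinity_def glued_complex_def)
    qed
  qed
  then show ?thesis
    using h unfolding cw_isomorphic_def
    by (intro exI[of _ h]) (simp add: tiling_complex_def sigma_infinity_def glued_complex_def discs_def)
qed

theorem proposition3p11:
  shows "\<exists>(P :: ('l :: finite) labelled set set) (T :: 'l labelled set).
           geometric_realization P T sigma_infinity"
proof -
  have "geometric_realization prototiles (tiles (undefined :: 'l)) sigma_infinity"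
    unfolding geometric_realization_def polygonal_tiling_def
  proof (intro conjI exI[of _ vertices])
    show "\<forall>t\<in>tiles (undefined :: 'l). polygon (fst t)"
      and "\<forall>t\<in>tiles (undefined :: 'l). fst t homeomorphic (cball 0 1 :: (real ^ 2) set)"
      by (simp_all add: tiles_def polygon_tile tile_homeomorphic_disc)
  qed (rule tiling_modeled_on_tiles branch_points_subset vertices_subset cw_isomorphic_tiles)+
  then show ?thesis by blast
qed

end
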